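(* Let $\{S_n\}$ be the SRRW-RVM with recollection probability $p\in[0,1)$, memory sequence $\{\mu_n\}$ regularly varying of index $\gamma>-1$, and zero mean innovation sequence $\{\xi_n\}_{n\ge1}$. Then the process $\left(S_{\lfloor nt\rfloor}/n:t\ge0\right)$ converges to the identically zero process almost surely and in $L^1$, as random elements of $D([0,\infty))$. Furthermore, if the innovation variables have finite variance, the convergence is in $L^2$.
   Context: Model (SRRW-RVM). Fix $p\in[0,1]$ (recollection probability) and $\gamma>-1$. Let $\{\mu_n\}_{n\ge1}$ (memory sequence) be a sequence of positive reals, regularly varying of index $\gamma$: $\mu_{\lfloor\lambda n\rfloor}/\mu_n\to\lambda^\gamma$ for every $\lambda>0$. Put $\nu_n=\sum_{k=1}^n\mu_k$. Let $\{\xi_n\}_{n\ge1}$ (innovation sequence) be i.i.d. real random variables with (finite) mean $0$; $\{\alpha_n\}_{n\ge2}$ i.i.d. Bernoulli($p$); $\{\beta_n\}_{n\ge2}$ independent with $\mathbb{P}(\beta_n=k)=\mu_k/\nu_{n-1}$ for $1\le k\le n-1$; the three sequences are independent of each other. Set $X_1=\xi_1$ and, for $n\ge1$, $X_{n+1}=\alpha_{n+1}X_{\beta_{n+1}}+(1-\alpha_{n+1})\xi_{n+1}$. The walk is $S_0=0$, $S_n=\sum_{k=1}^nX_k$. $D([0,\infty))$ is the space of r.c.l.l. functions on $[0,\infty)$ with the Skorohod topology. Convergence almost surely (resp. in $L^r$) in $D([0,\infty))$ of processes $Y_n$ to a process $Y$ with continuous paths means: for every $T>0$, $\sup_{0\le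 t\le T}|Y_n(t)-Y(t)|\to0$ almost surely (resp. in $L^r$). *)

theory Defs
  imports "HOL-Probability.Probability"
begin

definition regularly_varying_seq :: "real \<Rightarrow> (nat \<Rightarrow> real) \<Rightarrow> bool" where
  "regularly_varying_seq \<gamma> \<mu> \<longleftrightarrow>
     (\<forall>n\<ge>1. \<mu> n > 0) \<and>
     (\<forall>l>0. (\<lambda>n. \<mu> (nat \<lfloor>l * real n\<rfloor>) / \<mu> n) \<longlonglongrightarrow> l powr \<gamma>)"

definition memory_sum :: "(nat \<Rightarrow> real) \<Rightarrow> nat \<Rightarrow> real" where
  "memory_sum \<mu> n = (\<Sum>k=1..n. \<mu> k)"

text \<open>The sigma-algebra on the sample space generated by the whole family \<open>(Y i)\<close>, \<open>i \<in> I\<close>.\<close>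

definition generated_events ::
    "'a measure \<Rightarrow> 'b measure \<Rightarrow> (nat \<Rightarrow> 'a \<Rightarrow> 'b) \<Rightarrow> nat set \<Rightarrow> 'a set set" where
  "generated_events M N Y I =
     sets (vimage_algebra (space M) (\<lambda>\<omega>. \<lambda>i\<in>I. Y i \<omega>) (PiM I (\<lambda>_. N)))"

locale srrw_rvm = prob_space M
  for M :: "'a measure"
    and p :: real and \<gamma> :: real and \<mu> :: "nat \<Rightarrow> real"
    and \<xi> :: "nat \<Rightarrow> 'a \<Rightarrow> real"
    and \<alpha> :: "nat \<Rightarrow> 'a \<Rightarrow> bool"
    and \<beta> :: "nat \<Rightarrow> 'a \<Rightarrow> nat" +
  assumes p_range: "0 \<le> p" "p \<le> 1"
    and gamma_gt: "\<gamma> > -1"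
    and mu_regularly_varying: "regularly_varying_seq \<gamma> \<mu>"
    and xi_indep: "indep_vars (\<lambda>_. borel) \<xi> {1..}"
    and xi_ident: "\<And>n. n \<ge> 1 \<Longrightarrow> distr M borel (\<xi> n) = distr M borel (\<xi> 1)"
    and xi_integrable: "integrable M (\<xi> 1)"
    and xi_mean_zero: "expectation (\<xi> 1) = 0"
    and alpha_indep: "indep_vars (\<lambda>_. count_space UNIV) \<alpha> {2..}"
    and alpha_distr:
      "\<And>n. n \<ge> 2 \<Longrightarrow> distr M (count_space UNIV) (\<alpha> n) = measure_pmf (bernoulli_pmf p)"
    and beta_indep: "indep_vars (\<lambda>_. count_space UNIV) \<beta> {2..}"
    and beta_distr:
      "\<And>n k. n \<ge> 2 \<Longrightarrow> 1 \<le> k \<Longrightarrow> k \<le> n - 1 \<Longrightarrow>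
         prob {\<omega> \<in> space M. \<beta> n \<omega> = k} = \<mu> k / memory_sum \<mu> (n - 1)"
    and sequences_indep:
      "indep_sets
         ((!) [generated_events M borel \<xi> {1..},
               generated_events M (count_space UNIV) \<alpha> {2..},
               generated_events M (count_space UNIV) \<beta> {2..}])
         {0, 1, 2}"

text \<open>The steps \<open>X\<^sub>n\<close>, \<open>n \<ge> 1\<close>.  The values \<open>0\<close> at index \<open>0\<close> and for \<open>\<beta>\<close> outside its range
  are only there to make the recursion total: in \<^locale>\<open>srrw_rvm\<close> the event that \<open>\<beta> n\<close> is not in
  \<open>{1..n-1}\<close> has probability zero.\<close>

fun srrw_step ::
    "(nat \<Rightarrow> 'a \<Rightarrow> real) \<Rightarrow> (nat \<Rightarrow> 'a \<Rightarrow> bool) \<Rightarrow> (nat \<Rightarrow> 'a \<Rightarrow> nat) \<Rightarrow> nat \<Rightarrow> 'a \<Rightarrow> real" where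
  "srrw_step \<xi> \<alpha> \<beta> 0 \<omega> = 0"
| "srrw_step \<xi> \<alpha> \<beta> (Suc 0) \<omega> = \<xi> 1 \<omega>"
| "srrw_step \<xi> \<alpha> \<beta> (Suc (Suc n)) \<omega> =
     of_bool (\<alpha> (Suc (Suc n)) \<omega>) *
       (if \<beta> (Suc (Suc n)) \<omega> \<in> {1..Suc n} then srrw_step \<xi> \<alpha> \<beta> (\<beta> (Suc (Suc n)) \<omega>) \<omega> else 0)
     + (1 - of_bool (\<alpha> (Suc (Suc n)) \<omega>)) * \<xi> (Suc (Suc n)) \<omega>"

definition srrw ::
    "(nat \<Rightarrow> 'a \<Rightarrow> real) \<Rightarrow> (nat \<Rightarrow> 'a \<Rightarrow> bool) \<Rightarrow> (nat \<Rightarrow> 'a \<Rightarrow> nat) \<Rightarrow> nat \<Rightarrow> 'a \<Rightarrow> real" where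
  "srrw \<xi> \<alpha> \<beta> n \<omega> = (\<Sum>k=1..n. srrw_step \<xi> \<alpha> \<beta> k \<omega>)"

definition rcll :: "(real \<Rightarrow> real) \<Rightarrow> bool" where
  "rcll f \<longleftrightarrow>
     (\<forall>t\<ge>0. (f \<longlongrightarrow> f t) (at_right t)) \<and> (\<forall>t>0. \<exists>l. (f \<longlongrightarrow> l) (at_left t))"

text \<open>Random elements of \<open>D([0,\<infinity>))\<close>.  The Borel sigma-algebra of the Skorohod topology is the one
  generated by the coordinate maps, so measurability is asked coordinatewise.
  Values at negative times are irrelevant.\<close>

definition random_element_D :: "'a measure \<Rightarrow> (real \<Rightarrow> 'a \<Rightarrow> real) \<Rightarrow> bool" where
  "random_element_D M Y \<longleftrightarrow>
     (\<forall>t\<ge>0. Y t \<in> borel_measurable M) \<and> (\<forall>\<omega>\<in>space M. rcll (\<lambda>t. Y t \<omega>))"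

text \<open>The supremum over \<open>[0,T]\<close> is taken in \<^typ>\<open>ennreal\<close>, so that it is meaningful for
  arbitrary paths.\<close>

definition sup_dist ::
    "real \<Rightarrow> (real \<Rightarrow> 'a \<Rightarrow> real) \<Rightarrow> (real \<Rightarrow> 'a \<Rightarrow> real) \<Rightarrow> 'a \<Rightarrow> ennreal" where
  "sup_dist T Y Z \<omega> = (SUP t\<in>{0..T}. ennreal \<bar>Y t \<omega> - Z t \<omega>\<bar>)"

definition converges_as_in_D ::
    "'a measure \<Rightarrow> (nat \<Rightarrow> real \<Rightarrow> 'a \<Rightarrow> real) \<Rightarrow> (real \<Rightarrow> 'a \<Rightarrow> real) \<Rightarrow> bool" where
  "converges_as_in_D M Y Z \<longleftrightarrow>
     (\<forall>n. random_element_D M (Y n)) \<and> random_element_D M Z \<and>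
     (\<forall>\<omega>\<in>space M. continuous_on {0..} (\<lambda>t. Z t \<omega>)) \<and>
     (\<forall>T>0. AE \<omega> in M. (\<lambda>n. sup_dist T (Y n) Z \<omega>) \<longlonglongrightarrow> 0)"

definition converges_Lr_in_D ::
    "nat \<Rightarrow> 'a measure \<Rightarrow> (nat \<Rightarrow> real \<Rightarrow> 'a \<Rightarrow> real) \<Rightarrow> (real \<Rightarrow> 'a \<Rightarrow> real) \<Rightarrow> bool" where
  "converges_Lr_in_D r M Y Z \<longleftrightarrow>
     (\<forall>n. random_element_D M (Y n)) \<and> random_element_D M Z \<and>
     (\<forall>\<omega>\<in>space M. continuous_on {0..} (\<lambda>t. Z t \<omega>)) \<and>
     (\<forall>T>0. (\<forall>n. (\<integral>\<^sup>+ \<omega>. sup_dist T (Y n) Z \<omega> ^ r \<partial>M) < \<infinity>) \<and>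
            (\<lambda>n. \<integral>\<^sup>+ \<omega>. sup_dist T (Y n) Z \<omega> ^ r \<partial>M) \<longlonglongrightarrow> 0)"

text \<open>The process \<open>t \<mapsto> S\<^bsub>\<lfloor>nt\<rfloor>\<^esub> / n\<close>; it is \<open>0\<close> for \<open>n = 0\<close>.\<close>

definition scaled_srrw ::
    "(nat \<Rightarrow> 'a \<Rightarrow> real) \<Rightarrow> (nat \<Rightarrow> 'a \<Rightarrow> bool) \<Rightarrow> (nat \<Rightarrow> 'a \<Rightarrow> nat) \<Rightarrow>
      nat \<Rightarrow> real \<Rightarrow> 'a \<Rightarrow> real" where
  "scaled_srrw \<xi> \<alpha> \<beta> n t \<omega> = srrw \<xi> \<alpha> \<beta> (nat \<lfloor>real n * t\<rfloor>) \<omega> / real n"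

end

theory Submission
  imports Defs
begin

text \<open>With \<open>\<nu>\<^sub>n = \<mu>\<^sub>1 + \<dots> + \<mu>\<^sub>n\<close>, the weighted average \<open>W\<^sub>n = (\<Sum>k\<le>n. \<mu>\<^sub>k X\<^sub>k) / \<nu>\<^sub>n\<close> obeys the
  stochastic approximation \<open>W' = (1 - (1 - p) a) W + a (X' - p W)\<close> with steps \<open>a = \<mu>\<^sub>n / \<nu>\<^sub>n\<close>, where
  \<open>p W\<^sub>n\<close> is the conditional mean of \<open>X\<^sub>n\<^sub>+\<^sub>1\<close>.  Regular variation gives \<open>a = O(1/n)\<close> and a divergent sum
  of steps.  All \<open>X\<^sub>k\<close> have the law of \<open>\<xi>\<^sub>1\<close>, so they may be truncated at level \<open>k\<close>: by Borel--Cantelli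
  the truncation eventually changes neither \<open>X\<^sub>k\<close> nor \<open>W\<^sub>k\<close>, and the weighted truncated noise is a
  square-integrable martingale that converges.  Hence \<open>W\<^sub>n\<close> tends to \<open>0\<close>, and then \<open>S\<^sub>n / n\<close>, which obeys a
  recursion of the same kind with steps \<open>1/n\<close> and drift \<open>p W\<^sub>n\<close>, tends to \<open>0\<close> as well.  Since the running
  maximum of \<open>\<bar>S\<bar>\<^sup>r / n\<^sup>r\<close> is dominated by averages of the identically distributed \<open>\<bar>X\<^sub>k\<bar>\<^sup>r\<close>, \<open>r = 1, 2\<close>, uniform
  integrability upgrades almost sure convergence to convergence in \<open>L\<^sup>r\<close>.\<close>

section \<open>Stochastic approximation\<close>

text \<open>Only a first moment is given, so the raw noise has no variance to sum. After truncation
  the n-th variance is weighted by the square of the step; these products are summable because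
  E|\<open>\<xi> 1\<close>| is finite, provided the steps are O(1/n). This is why a rate for
  \<open>\<mu> n / memory_sum \<mu> n\<close> is proved and not merely its convergence to 0. The
  noise at time \<open>Suc n\<close> truncates every remembered step at the one level
  \<open>Suc n\<close>. The compensator is then the exact conditional mean, and on almost every path
  all truncations up to time n become inactive together. Truncation also spoils the zero mean; the
  bias that it leaves is a vanishing perturbation of the recursion. The two strict inequalities act
  at separate points. \<open>\<gamma> > -1\<close> makes the memory sum diverge, hence the sum of
  the steps. \<open>p < 1\<close> makes the contraction rate 1 - p positive: for p = 1 almost surely
  every step repeats \<open>\<xi> 1\<close>, and so does S_n / n.\<close>

lemma recursion_tendsto_zero:
  fixes a e v :: "nat \<Rightarrow> real"
  assumes c: "c > 0" and a: "\<And>n. 0 \<le> a n" "\<And>n. c * a n \<le> 1"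
    and nsum: "\<not> summable a" and e: "e \<longlonglongrightarrow> 0"
    and rec: "\<And>n. v (Suc n) = (1 - c * a n) * v n + a n * e n"
  shows "v \<longlonglongrightarrow> 0"
proof (rule LIMSEQ_I)
  fix r :: real assume r: "r > 0"
  \<comment> \<open>The equilibrium of the recursion is e / c, so the smallness of e is measured
    relative to c.\<close>
  from e c r have "eventually (\<lambda>n. \<bar>e n\<bar> < c * (r / 2)) sequentially"
    by (intro order_tendstoD(2)[OF tendsto_rabs_zero]) auto
  then obtain N where N: "\<And>n. n \<ge> N \<Longrightarrow> \<bar>e n\<bar> < c * (r / 2)"
    by (auto simp: eventually_sequentially)
  define s where "s m = (\<Sum>k<m. a (k + N))" for m
  have "\<not> summable (\<lambda>k. a (k + N))" using nsum by (simp add: summable_iff_shift)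
  then have unb: "\<exists>m. s m > x" for x
    using summableI_nonneg_bounded[of "\<lambda>k. a (k + N)" x] a(1) unfolding s_def
    by (meson not_le_imp_less)
  have mono: "m \<le> m' \<Longrightarrow> s m \<le> s m'" for m m'
    unfolding s_def by (intro sum_mono2) (auto simp: a)
  have "filterlim s at_top sequentially"
    unfolding filterlim_at_top eventually_sequentially
    by (meson unb mono less_imp_le order_trans)
  then have "filterlim (\<lambda>m. c * s m) at_top sequentially"
    by (rule filterlim_tendsto_pos_mult_at_top[OF tendsto_const c])
  then have "((\<lambda>m. exp (- (c * s m))) \<longlongrightarrow> 0) sequentially"
    by (intro filterlim_compose[OF exp_at_bot] filterlim_compose[OF filterlim_uminus_at_bot_at_top])
  then have "((\<lambda>m. \<bar>v N\<bar> * exp (- (c * s m))) \<longlongrightarrow> 0) sequentially"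
    by (rule tendsto_mult_right_zero)
  from order_tendstoD(2)[OF this, of "r/2"] r
  obtain m0 where m0: "\<And>m. m \<ge> m0 \<Longrightarrow> \<bar>v N\<bar> * exp (- (c * s m)) < r / 2"
    by (auto simp: eventually_sequentially)
  \<comment> \<open>The level r / 2 is preserved because the perturbation is below c * (r / 2). The
    initial error is multiplied by factors 1 - c * a <= exp (- (c * a)), and divergence of the sum
    of a sends their product to 0.\<close>
  have bound: "\<bar>v (m + N)\<bar> \<le> r / 2 + \<bar>v N\<bar> * exp (- (c * s m))" for m
  proof (induction m)
    case 0
    then show ?case using r by (simp add: s_def)
  next
    case (Suc m)
    let ?a = "a (m + N)" and ?E = "\<bar>v N\<bar> * exp (- (c * s m))"
    have nn: "0 \<le> 1 - c * ?a" "0 \<le> ?a" using a by (simp_all add: algebra_simps)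
    have "\<bar>v (Suc m + N)\<bar> \<le> \<bar>(1 - c * ?a) * v (m + N)\<bar> + \<bar>?a * e (m + N)\<bar>"
      by (simp add: rec)
    also have "\<dots> = (1 - c * ?a) * \<bar>v (m + N)\<bar> + ?a * \<bar>e (m + N)\<bar>"
      using nn by (simp add: abs_mult)
    also have "\<dots> \<le> (1 - c * ?a) * (r / 2 + ?E) + ?a * (c * (r / 2))"
      using nn Suc N[of "m + N"] by (intro add_mono mult_left_mono) auto
    also have "\<dots> = r / 2 + (1 - c * ?a) * ?E" by (simp add: algebra_simps)
    also have "\<dots> \<le> r / 2 + exp (- (c * ?a)) * ?E"
      using exp_ge_add_one_self[of "- (c * ?a)"] by (intro add_left_mono mult_right_mono) auto
    also have "exp (- (c * ?a)) * ?E = \<bar>v N\<bar> * exp (- (c * s (Suc m)))"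
      by (simp add: s_def exp_add[symmetric] algebra_simps)
    finally show ?case .
  qed
  have "norm (v n - 0) < r" if "n \<ge> m0 + N" for n
  proof -
    have "m0 \<le> n - N" using that by simp
    from bound[of "n - N"] m0[OF this] that show ?thesis by simp
  qed
  then show "\<exists>no. \<forall>n\<ge>no. norm (v n - 0) < r" by blast
qed

text \<open>A deterministic statement, to be applied path by path. The recursion is asked only
  eventually, since truncated and true increments agree only from a random index on.\<close>

lemma stochastic_approximation_tendsto_zero:
  fixes a d \<delta> w :: "nat \<Rightarrow> real"
  assumes c: "c > 0" and a0: "\<And>n. 0 \<le> a n" and a: "a \<longlonglongrightarrow> 0"
    and nsum: "\<not> summable a" and d: "summable (\<lambda>n. a n * d n)" and \<delta>: "\<delta> \<longlonglongrightarrow> 0"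
    and rec: "\<forall>\<^sub>F n in sequentially. w (Suc n) = (1 - c * a n) * w n + a n * (\<delta> n + d n)"
  shows "w \<longlonglongrightarrow> 0"
proof -
  have "\<forall>\<^sub>F n in sequentially. c * a n < 1"
    by (rule order_tendstoD(2)[OF tendsto_mult_right_zero[OF a]]) simp
  with rec have "\<forall>\<^sub>F n in sequentially. c * a n \<le> 1 \<and>
      w (Suc n) = (1 - c * a n) * w n + a n * (\<delta> n + d n)"
    by eventually_elim auto
  then obtain N where N: "\<And>n. n \<ge> N \<Longrightarrow> c * a n \<le> 1"
      "\<And>n. n \<ge> N \<Longrightarrow> w (Suc n) = (1 - c * a n) * w n + a n * (\<delta> n + d n)"
    by (auto simp: eventually_sequentially)
  define r where "r n = (\<Sum>k. a k * d k) - (\<Sum>k<n. a k * d k)" for n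
  have r: "r \<longlonglongrightarrow> 0"
    unfolding r_def using tendsto_diff[OF tendsto_const[of "\<Sum>k. a k * d k"] summable_LIMSEQ[OF d]] by simp
  \<comment> \<open>Adding the tail of the noise series removes the noise from the recursion.\<close>
  have "(\<lambda>n. w (n + N) + r (n + N)) \<longlonglongrightarrow> 0"
  proof (rule recursion_tendsto_zero[OF c])
    show "0 \<le> a (n + N)" "c * a (n + N) \<le> 1" for n using a0 N by auto
    show "\<not> summable (\<lambda>n. a (n + N))" using nsum by (simp add: summable_iff_shift)
    \<comment> \<open>The shift by the tail costs the additional perturbation \<open>c * r\<close>,
      which vanishes because the noise series converges.\<close>
    show "(\<lambda>n. \<delta> (n + N) + c * r (n + N)) \<longlonglongrightarrow> 0"
      using tendsto_add[OF \<delta> tendsto_mult_right_zero[OF r]]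
      by (intro LIMSEQ_ignore_initial_segment[where f="\<lambda>n. \<delta> n + c * r n"]) simp
    show "w (Suc n + N) + r (Suc n + N) = (1 - c * a (n + N)) * (w (n + N) + r (n + N)) +
        a (n + N) * (\<delta> (n + N) + c * r (n + N))" for n
      using N(2)[of "n + N"] by (simp add: r_def algebra_simps)
  qed
  then have "(\<lambda>n. w n + r n) \<longlonglongrightarrow> 0" by (rule LIMSEQ_offset)
  from tendsto_diff[OF this r] show ?thesis by simp
qed

section \<open>Regularly varying memory\<close>

lemma memory_sum_mono:
  assumes "\<And>k. k \<ge> 1 \<Longrightarrow> \<mu> k > 0" "m \<le> n"
  shows "memory_sum \<mu> m \<le> memory_sum \<mu> n"
  unfolding memory_sum_def using assms by (intro sum_mono2) (auto intro: less_imp_le)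

lemma memory_sum_pos:
  assumes "\<And>k. k \<ge> 1 \<Longrightarrow> \<mu> k > 0" "n \<ge> 1"
  shows "memory_sum \<mu> n > 0"
  unfolding memory_sum_def using assms by (intro sum_pos) auto

lemma memory_sum_Suc: "memory_sum \<mu> (Suc n) = memory_sum \<mu> n + \<mu> (Suc n)"
  by (simp add: memory_sum_def)

text \<open>The interval \<open>?I j\<close> is where \<open>t * real n\<close> has integer part j,
  so the integral of the step function is a part of the memory sum divided by n. Keeping t >= 1/2
  with n >= 2 avoids index 0, where \<open>\<mu>\<close> has no known sign.\<close>

lemma nn_integral_floor_le:
  assumes pos: "\<And>k. k \<ge> 1 \<Longrightarrow> \<mu> k > 0" and n: "n \<ge> 2"
  shows "(\<integral>\<^sup>+t\<in>{1/2..<1}. ennreal (\<mu> (nat \<lfloor>t * real n\<rfloor>)) \<partial>lborel) \<le> ennreal (memory_sum \<mu> n / real n)"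
proof -
  let ?I = "\<lambda>j. {real j / real n..<real (Suc j) / real n}"
  have le: "ennreal (\<mu> (nat \<lfloor>t * real n\<rfloor>)) * indicator {1/2..<1} t
      \<le> (\<Sum>j=1..n. ennreal (\<mu> j) * indicator (?I j) t)" for t :: real
  proof (cases "t \<in> {1/2..<1}")
    case True
    define j where "j = nat \<lfloor>t * real n\<rfloor>"
    have "1/2 * 2 \<le> t * real n" using True n by (intro mult_mono) auto
    then have j1: "j \<ge> 1" by (simp add: j_def le_nat_iff le_floor_iff)
    have "t * real n < 1 * real n" using True n by (intro mult_strict_right_mono) auto
    then have jn: "j \<le> n" unfolding j_def by linarith
    have jt: "real j \<le> t * real n" "t * real n < real j + 1"
      using True j1 unfolding j_def by auto
    then have "t \<in> ?I j" using n by (auto simp: field_simps)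
    then have "ennreal (\<mu> j) = (\<Sum>i\<in>{j}. ennreal (\<mu> i) * indicator (?I i) t)" by simp
    also have "\<dots> \<le> (\<Sum>i=1..n. ennreal (\<mu> i) * indicator (?I i) t)"
      using j1 jn by (intro sum_mono2) auto
    finally show ?thesis using True by (simp add: j_def)
  qed simp
  have "(\<integral>\<^sup>+t\<in>{1/2..<1}. ennreal (\<mu> (nat \<lfloor>t * real n\<rfloor>)) \<partial>lborel)
      \<le> (\<integral>\<^sup>+t. (\<Sum>j=1..n. ennreal (\<mu> j) * indicator (?I j) t) \<partial>lborel)"
    by (intro nn_integral_mono le)
  also have "\<dots> = (\<Sum>j=1..n. ennreal (\<mu> j) * emeasure lborel (?I j))"
    by (subst nn_integral_sum) (auto intro!: sum.cong nn_integral_cmult_indicator)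
  also have "\<dots> = (\<Sum>j=1..n. ennreal (\<mu> j / real n))"
    using n pos by (intro sum.cong)
      (auto simp: divide_right_mono ennreal_mult'[symmetric] diff_divide_distrib[symmetric] less_imp_le)
  also have "\<dots> = ennreal (memory_sum \<mu> n / real n)"
    using pos by (subst sum_ennreal) (auto simp: memory_sum_def sum_divide_distrib less_imp_le)
  finally show ?thesis .
qed

text \<open>Only the lower half of Karamata's theorem is needed; Fatou's lemma then replaces the
  uniform convergence theorem.\<close>

lemma regularly_varying_eventually_le:
  assumes rv: "regularly_varying_seq \<gamma> \<mu>"
  shows "\<exists>K>0. \<forall>\<^sub>F n in sequentially. K * (real n * \<mu> n) \<le> memory_sum \<mu> n"
proof -
  have pos: "\<And>k. k \<ge> 1 \<Longrightarrow> \<mu> k > 0"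
    and lim: "\<And>l. l > 0 \<Longrightarrow> (\<lambda>n. \<mu> (nat \<lfloor>l * real n\<rfloor>) / \<mu> n) \<longlonglongrightarrow> l powr \<gamma>"
    using rv by (auto simp: regularly_varying_seq_def)
  define f where "f n t = ennreal (\<mu> (nat \<lfloor>t * real n\<rfloor>) / \<mu> n) * indicator {1/2..<1} t" for n t
  \<comment> \<open>The infimum of \<open>t powr \<gamma>\<close> over [1/2, 1) is bounded by its
    value at one of the two ends, depending on the sign of \<open>\<gamma>\<close>; the final
    division by 2 is the length of the interval.\<close>
  define K0 where "K0 = min 1 ((1/2) powr \<gamma>) / 2"
  have K0: "K0 > 0" by (simp add: K0_def)
  have low: "min 1 ((1/2) powr \<gamma>) \<le> t powr \<gamma>" if "1/2 \<le> t" "t < 1" for t :: real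
  proof (cases "\<gamma> \<ge> 0")
    case True
    then have "(1/2) powr \<gamma> \<le> t powr \<gamma>" using that by (intro powr_mono2) auto
    then show ?thesis by simp
  next
    case False
    then have "1 powr \<gamma> \<le> t powr \<gamma>" using that by (intro powr_mono2') auto
    then show ?thesis by simp
  qed
  have "ennreal K0 = (\<integral>\<^sup>+t\<in>{1/2..<1::real}. ennreal (min 1 ((1/2) powr \<gamma>)) \<partial>lborel)"
    by (simp add: nn_integral_cmult_indicator K0_def divide_ennreal[symmetric] divide_ennreal_def)
  also have "\<dots> \<le> (\<integral>\<^sup>+t. liminf (\<lambda>n. f n t) \<partial>lborel)"
  proof (intro nn_integral_mono)
    fix t :: real
    show "ennreal (min 1 ((1/2) powr \<gamma>)) * indicator {1/2..<1} t \<le> liminf (\<lambda>n. f n t)"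
    proof (cases "t \<in> {1/2..<1}")
      case True
      then have "(\<lambda>n. f n t) \<longlonglongrightarrow> ennreal (t powr \<gamma>)"
        unfolding f_def using lim[of t] by (auto intro!: tendsto_ennrealI)
      then have "liminf (\<lambda>n. f n t) = ennreal (t powr \<gamma>)"
        by (intro lim_imp_Liminf) auto
      then show ?thesis using True low[of t] by (simp add: ennreal_leI)
    qed simp
  qed
  also have "\<dots> \<le> liminf (\<lambda>n. \<integral>\<^sup>+t. f n t \<partial>lborel)"
  proof (rule nn_integral_liminf)
    fix n
    have "(\<lambda>t::real. \<mu> (nat \<lfloor>t * real n\<rfloor>)) \<in> borel_measurable borel"
      by (rule measurable_compose[where N="count_space UNIV" and g=\<mu>]) measurable
    then show "f n \<in> borel_measurable lborel" unfolding f_def by measurable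
  qed
  finally have "ennreal K0 \<le> liminf (\<lambda>n. \<integral>\<^sup>+t. f n t \<partial>lborel)" .
  \<comment> \<open>Halving makes the inequality strict, so that it passes from the liminf to all
    large n.\<close>
  moreover have "ennreal (K0 / 2) < ennreal K0" using K0 by (simp add: ennreal_less_iff)
  ultimately have "ennreal (K0 / 2) < liminf (\<lambda>n. \<integral>\<^sup>+t. f n t \<partial>lborel)" by (rule less_le_trans[rotated])
  then have "\<forall>\<^sub>F n in sequentially. ennreal (K0 / 2) < (\<integral>\<^sup>+t. f n t \<partial>lborel)"
    using less_LiminfD by blast
  then have "\<forall>\<^sub>F n in sequentially. K0 / 2 * (real n * \<mu> n) \<le> memory_sum \<mu> n"
    using eventually_ge_at_top[of 2]
  proof eventually_elim
    case (elim n)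
    have mn: "\<mu> n > 0" using pos elim by auto
    have sp: "memory_sum \<mu> n > 0" using elim by (intro memory_sum_pos pos) auto
    have "(\<integral>\<^sup>+t. f n t \<partial>lborel) = (\<integral>\<^sup>+t. ennreal (1 / \<mu> n) * (ennreal (\<mu> (nat \<lfloor>t * real n\<rfloor>)) * indicator {1/2..<1} t) \<partial>lborel)"
      unfolding f_def using mn
      by (intro nn_integral_cong) (simp add: ennreal_mult''[symmetric] ennreal_mult'[symmetric] mult.assoc[symmetric])
    also have "\<dots> = ennreal (1 / \<mu> n) * (\<integral>\<^sup>+t\<in>{1/2..<1}. ennreal (\<mu> (nat \<lfloor>t * real n\<rfloor>)) \<partial>lborel)"
    proof (rule nn_integral_cmult)
      have "(\<lambda>t::real. \<mu> (nat \<lfloor>t * real n\<rfloor>)) \<in> borel_measurable borel"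
        by (rule measurable_compose[where N="count_space UNIV" and g=\<mu>]) measurable
      then show "(\<lambda>t. ennreal (\<mu> (nat \<lfloor>t * real n\<rfloor>)) * indicator {1/2..<1} t) \<in> borel_measurable lborel"
        by measurable
    qed
    also have "\<dots> \<le> ennreal (1 / \<mu> n) * ennreal (memory_sum \<mu> n / real n)"
      using nn_integral_floor_le[of \<mu>, OF pos] elim by (intro mult_left_mono) auto
    also have "\<dots> = ennreal (memory_sum \<mu> n / (\<mu> n * real n))"
      using mn sp by (simp add: ennreal_mult'[symmetric])
    finally have "ennreal (K0 / 2) < ennreal (memory_sum \<mu> n / (\<mu> n * real n))"
      using elim by simp
    then have "K0 / 2 < memory_sum \<mu> n / (\<mu> n * real n)"
      using K0 by (simp add: ennreal_less_iff)
    then show ?case using mn elim by (simp add: field_simps)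
  qed
  then show ?thesis using K0 by (intro exI[of _ "K0 / 2"]) auto
qed

text \<open>The finitely many early indices only enlarge the constant. A bound at every index is
  what \<open>AE_noise_summable\<close> asks of its weights.\<close>

lemma regularly_varying_ratio_bound:
  assumes rv: "regularly_varying_seq \<gamma> \<mu>"
  shows "\<exists>C. \<forall>n\<ge>1. \<mu> n / memory_sum \<mu> n \<le> C / real n"
proof -
  have pos: "\<And>k. k \<ge> 1 \<Longrightarrow> \<mu> k > 0" using rv by (auto simp: regularly_varying_seq_def)
  obtain K where K: "K > 0" "\<forall>\<^sub>F n in sequentially. K * (real n * \<mu> n) \<le> memory_sum \<mu> n"
    using regularly_varying_eventually_le[OF rv] by blast
  have spos: "\<And>n. n \<ge> 1 \<Longrightarrow> memory_sum \<mu> n > 0" by (intro memory_sum_pos pos)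
  have "\<forall>\<^sub>F n in sequentially. norm (real n * \<mu> n / memory_sum \<mu> n) \<le> norm (1 / K)"
    using K(2) eventually_ge_at_top[of 1]
  proof eventually_elim
    case (elim n)
    then show ?case using pos[of n] spos[of n] K(1)
      by (simp add: field_simps)
  qed
  then have "Bseq (\<lambda>n. real n * \<mu> n / memory_sum \<mu> n)"
    by (rule Bseq_eventually_mono) simp
  then obtain C where C: "\<And>n. norm (real n * \<mu> n / memory_sum \<mu> n) \<le> C"
    by (auto simp: Bseq_def)
  have "\<mu> n / memory_sum \<mu> n \<le> C / real n" if "n \<ge> 1" for n
    using C[of n] that pos[of n] spos[of n] by (simp add: field_simps)
  then show ?thesis by blast
qed

text \<open>Along a doubling sequence of indices m, the product of m and \<open>\<mu> m\<close>
  grows geometrically, since doubling multiplies it in the limit by 2 powr (\<open>\<gamma>\<close>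
  + 1) > 1. The lower Karamata bound hands this growth to the memory sum, and monotonicity covers
  the indices in between.\<close>

lemma memory_sum_at_top:
  assumes rv: "regularly_varying_seq \<gamma> \<mu>" and \<gamma>: "\<gamma> > -1"
  shows "filterlim (memory_sum \<mu>) at_top sequentially"
proof -
  have pos: "\<And>k. k \<ge> 1 \<Longrightarrow> \<mu> k > 0"
    and lim: "(\<lambda>n. \<mu> (nat \<lfloor>2 * real n\<rfloor>) / \<mu> n) \<longlonglongrightarrow> 2 powr \<gamma>"
    using rv by (auto simp: regularly_varying_seq_def)
  have fl: "nat \<lfloor>2 * real n\<rfloor> = 2 * n" for n by linarith
  obtain K where K: "K > 0" "\<forall>\<^sub>F n in sequentially. K * (real n * \<mu> n) \<le> memory_sum \<mu> n"
    using regularly_varying_eventually_le[OF rv] by blast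
  define q where "q = 2 powr ((\<gamma> - 1) / 2)"
  \<comment> \<open>\<open>2 q\<close> lies strictly between \<open>1\<close> and the limit \<open>2 powr (\<gamma> + 1)\<close> of \<open>2 n \<mu>\<^bsub>2n\<^esub> / (n \<mu>\<^sub>n)\<close>.\<close>
  have q: "q < 2 powr \<gamma>" "q > 0" using \<gamma> by (simp_all add: q_def)
  have "2 * q = 2 powr ((\<gamma> + 1) / 2)"
    by (simp add: q_def powr_mult_base field_simps)
  then have q2: "2 * q > 1" using \<gamma> by simp
  have "\<forall>\<^sub>F n in sequentially. q < \<mu> (2 * n) / \<mu> n"
    using order_tendstoD(1)[OF lim q(1)] by (simp add: fl)
  with K(2) have "\<forall>\<^sub>F n in sequentially. q < \<mu> (2 * n) / \<mu> n \<and> K * (real n * \<mu> n) \<le> memory_sum \<mu> n"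
    by eventually_elim auto
  then obtain N where N: "\<And>n. n \<ge> N \<Longrightarrow> q < \<mu> (2 * n) / \<mu> n"
      "\<And>n. n \<ge> N \<Longrightarrow> K * (real n * \<mu> n) \<le> memory_sum \<mu> n"
    by (auto simp: eventually_sequentially)
  define m where "m i = 2 ^ i * Suc N" for i :: nat
  have mN: "m i \<ge> N" "m i \<ge> 1" for i
  proof -
    have "1 * Suc N \<le> m i" unfolding m_def by (intro mult_right_mono) auto
    then show "m i \<ge> N" "m i \<ge> 1" by auto
  qed
  have grow: "real (m i) * \<mu> (m i) \<ge> (2 * q) ^ i * (real (m 0) * \<mu> (m 0))" for i
  proof (induction i)
    case (Suc i)
    have "m (Suc i) = 2 * m i" by (simp add: m_def)
    moreover have "q * \<mu> (m i) \<le> \<mu> (2 * m i)"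
      using N(1)[OF mN(1)[of i]] pos[OF mN(2)[of i]] by (simp add: field_simps)
    ultimately have "2 * q * (real (m i) * \<mu> (m i)) \<le> real (m (Suc i)) * \<mu> (m (Suc i))"
      by (simp add: mult_left_mono mult.left_commute[of q])
    moreover have "2 * q * ((2 * q) ^ i * (real (m 0) * \<mu> (m 0))) \<le> 2 * q * (real (m i) * \<mu> (m i))"
      using Suc q by (intro mult_left_mono) auto
    ultimately show ?case by (simp add: mult.assoc)
  qed simp
  have "filterlim (\<lambda>i. (2 * q) ^ i) at_top sequentially"
    using filterlim_at_infinity_imp_filterlim_at_top[OF filterlim_realpow_sequentially_gt1[of "2 * q"]] q q2
    by simp
  then have g: "filterlim (\<lambda>i. K * (real (m 0) * \<mu> (m 0)) * (2 * q) ^ i) at_top sequentially"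
    using K(1) pos[OF mN(2)[of 0]] mN(2)[of 0]
    by (intro filterlim_tendsto_pos_mult_at_top[OF tendsto_const]) auto
  have ge: "memory_sum \<mu> (m i) \<ge> K * (real (m 0) * \<mu> (m 0)) * (2 * q) ^ i" for i
  proof -
    have "K * ((2 * q) ^ i * (real (m 0) * \<mu> (m 0))) \<le> K * (real (m i) * \<mu> (m i))"
      using K(1) grow[of i] by (intro mult_left_mono) auto
    also have "\<dots> \<le> memory_sum \<mu> (m i)" by (rule N(2)[OF mN(1)])
    finally show ?thesis by (simp add: mult_ac)
  qed
  show ?thesis unfolding filterlim_at_top eventually_sequentially
  proof
    fix Z :: real
    from g obtain i where "Z \<le> K * (real (m 0) * \<mu> (m 0)) * (2 * q) ^ i"
      unfolding filterlim_at_top eventually_sequentially by blast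
    with ge[of i] have Z: "Z \<le> memory_sum \<mu> (m i)" by linarith
    have "Z \<le> memory_sum \<mu> n" if "n \<ge> m i" for n
      using memory_sum_mono[of \<mu>, OF pos that] Z by linarith
    then show "\<exists>N. \<forall>n\<ge>N. Z \<le> memory_sum \<mu> n" by blast
  qed
qed

text \<open>The divergence half of the Abel-Dini theorem. Once the memory sum has more than doubled
  since index m, replacing every denominator of the block by the largest one still leaves at least
  1/2, against the Cauchy criterion.\<close>

lemma not_summable_memory_ratio:
  assumes pos: "\<And>k. k \<ge> 1 \<Longrightarrow> \<mu> k > 0" and top: "filterlim (memory_sum \<mu>) at_top sequentially"
  shows "\<not> summable (\<lambda>n. \<mu> (Suc n) / memory_sum \<mu> (Suc n))"
proof
  let ?a = "\<lambda>n. \<mu> (Suc n) / memory_sum \<mu> (Suc n)"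
  assume "summable ?a"
  then have "\<exists>m. \<forall>n. norm (sum ?a {m..<n}) < 1 / 2"
    unfolding summable_Cauchy by (drule_tac spec[of _ "1 / 2"]) auto
  then obtain m where m: "\<And>n. norm (sum ?a {m..<n}) < 1 / 2"
    by blast
  from top have "\<forall>\<^sub>F n in sequentially. memory_sum \<mu> n > 2 * memory_sum \<mu> m" 
    by (simp add: filterlim_at_top_dense)
  then have "\<forall>\<^sub>F n in sequentially. memory_sum \<mu> n > 2 * memory_sum \<mu> m \<and> n > m"
    using eventually_gt_at_top[of m] by eventually_elim auto
  then obtain n where n: "memory_sum \<mu> n > 2 * memory_sum \<mu> m" "n > m"
    by (auto simp: eventually_sequentially)
  have np: "memory_sum \<mu> n > 0" using n by (intro memory_sum_pos pos) auto
  have "(\<Sum>k\<in>{m..<n}. \<mu> (Suc k)) = memory_sum \<mu> n - memory_sum \<mu> m"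
    using n(2) sum_Suc_diff'[of m n "memory_sum \<mu>"] by (simp add: memory_sum_Suc)
  then have "1 / 2 \<le> (\<Sum>k\<in>{m..<n}. \<mu> (Suc k)) / memory_sum \<mu> n"
    using n np by (simp add: field_simps)
  also have "\<dots> = (\<Sum>k\<in>{m..<n}. \<mu> (Suc k) / memory_sum \<mu> n)" by (rule sum_divide_distrib)
  also have "\<dots> \<le> sum ?a {m..<n}"
    using memory_sum_mono[of \<mu>, OF pos] memory_sum_pos[of \<mu>, OF pos] pos
    by (intro sum_mono divide_left_mono) (auto intro!: mult_pos_pos np less_imp_le)
  finally show False using m[of n] by simp
qed

section \<open>Square-integrable martingales\<close>

context prob_space
begin

lemma integrable_bounded:
  fixes f :: "'a \<Rightarrow> real"
  assumes "f \<in> borel_measurable M" "\<And>\<omega>. \<omega> \<in> space M \<Longrightarrow> \<bar>f \<omega>\<bar> \<le> B"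
  shows "integrable M f"
  using assms by (intro integrable_const_bound[of f B]) auto

text \<open>Bounded martingale differences: the martingale property is only stated against bounded test
  functions, which avoids conditional expectations.\<close>

lemma kolmogorov_maximal_inequality:
  fixes d :: "nat \<Rightarrow> 'a \<Rightarrow> real" and F :: "nat \<Rightarrow> 'a measure"
  assumes F: "\<And>n. sets (F n) \<subseteq> sets M" "\<And>n. space (F n) = space M" "\<And>n. sets (F n) \<subseteq> sets (F (Suc n))"
    and meas: "\<And>n. d n \<in> borel_measurable (F (Suc n))"
    and bdd: "\<And>n. \<exists>B. \<forall>\<omega>\<in>space M. \<bar>d n \<omega>\<bar> \<le> B"
    and orth: "\<And>n G. G \<in> borel_measurable (F n) \<Longrightarrow> (\<exists>B. \<forall>\<omega>\<in>space M. \<bar>G \<omega>\<bar> \<le> B) \<Longrightarrow>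
        expectation (\<lambda>\<omega>. G \<omega> * d n \<omega>) = 0"
    and e: "e > 0"
  shows "prob {\<omega>\<in>space M. \<exists>k\<le>n. e < \<bar>\<Sum>i=m..<m+k. d i \<omega>\<bar>} \<le> (\<Sum>i=m..<m+n. expectation (\<lambda>\<omega>. (d i \<omega>)\<^sup>2)) / e\<^sup>2"
proof -
  define S where "S k \<omega> = (\<Sum>i=m..<m+k. d i \<omega>)" for k \<omega>
  have Fmono: "sets (F i) \<subseteq> sets (F j)" if "i \<le> j" for i j
    using F(3) that by (rule lift_Suc_mono_le)
  have FF: "f \<in> borel_measurable (F j)" if "f \<in> borel_measurable (F i)" "i \<le> j" for f :: "'a \<Rightarrow> real" and i j
    using that Fmono[OF that(2)] F(2) by (auto simp: measurable_def)
  have FM: "f \<in> borel_measurable M" if "f \<in> borel_measurable (F i)" for f :: "'a \<Rightarrow> real" and i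
    using that F(1)[of i] F(2)[of i] by (auto simp: measurable_def)
  have Sm: "S k \<in> borel_measurable (F (m + k))" for k
    unfolding S_def using meas by (intro borel_measurable_sum FF[OF meas]) auto
  have [measurable]: "S k \<in> borel_measurable M" "d i \<in> borel_measurable M" for k i
    using FM[OF Sm] FM[OF meas] by auto
  obtain Bd where Bd: "\<And>i \<omega>. \<omega> \<in> space M \<Longrightarrow> \<bar>d i \<omega>\<bar> \<le> Bd i" using bdd by metis
  define BS where "BS k = (\<Sum>i=m..<m+k. Bd i)" for k
  have BS: "\<bar>S k \<omega>\<bar> \<le> BS k" if "\<omega> \<in> space M" for k \<omega>
    unfolding S_def BS_def using Bd[OF that] by (intro order_trans[OF sum_abs] sum_mono) auto
  \<comment> \<open>First passage at k. The event is decided at time m + k, so its indicator is an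
    admissible test function against all later differences.\<close>
  define A where "A k = {\<omega>\<in>space M. e < \<bar>S k \<omega>\<bar> \<and> (\<forall>j<k. \<bar>S j \<omega>\<bar> \<le> e)}" for k
  have AF: "A k \<in> sets (F (m + k))" for k
  proof -
    \<comment> \<open>For k = 0 the intersection over the empty index set is \<open>UNIV\<close>;
      intersecting with the space repairs this.\<close>
    have "A k = {\<omega>\<in>space (F (m + k)). e < \<bar>S k \<omega>\<bar>} \<inter> (\<Inter>j\<in>{..<k}. {\<omega>\<in>space (F (m + k)). \<bar>S j \<omega>\<bar> \<le> e}) \<inter> space (F (m + k))"
      by (auto simp: A_def F(2))
    moreover have "{\<omega>\<in>space (F (m + k)). e < \<bar>S k \<omega>\<bar>} \<in> sets (F (m + k))"
      using Sm[of k] by measurable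
    moreover have "{\<omega>\<in>space (F (m + k)). \<bar>S j \<omega>\<bar> \<le> e} \<in> sets (F (m + k))" if "j < k" for j
    proof -
      have "S j \<in> borel_measurable (F (m + k))" using FF[OF Sm[of j], of "m + k"] that by simp
      then show ?thesis by measurable
    qed
    then have "(\<Inter>j\<in>{..<k}. {\<omega>\<in>space (F (m + k)). \<bar>S j \<omega>\<bar> \<le> e}) \<inter> space (F (m + k)) \<in> sets (F (m + k))"
      by (cases "k = 0") (auto intro!: sets.Int sets.finite_INT)
    ultimately show ?thesis by (metis (no_types, lifting) inf_assoc sets.Int)
  qed
  have AM [measurable]: "A k \<in> sets M" for k using AF F(1) by blast
  have step: "S k \<omega> + d (m + k) \<omega> = S (Suc k) \<omega>" for k \<omega> by (simp add: S_def)
  have int2: "integrable M (\<lambda>\<omega>. indicat_real B \<omega> * (S k \<omega>)\<^sup>2)" if [measurable]: "B \<in> sets M" for B k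
  proof (rule integrable_bounded[where B="(BS k)\<^sup>2"])
    fix \<omega> assume "\<omega> \<in> space M"
    then have "(S k \<omega>)\<^sup>2 \<le> (BS k)\<^sup>2"
      using order_trans[OF BS abs_ge_self] by (intro abs_le_square_iff[THEN iffD1])
    then show "\<bar>indicat_real B \<omega> * (S k \<omega>)\<^sup>2\<bar> \<le> (BS k)\<^sup>2" by (auto simp: indicator_def)
  qed measurable
  \<comment> \<open>The cross term vanishes because \<open>G * S k\<close> is known at time \<open>m + k\<close>.\<close>
  have second: "expectation (\<lambda>\<omega>. indicat_real B \<omega> * (S (Suc k) \<omega>)\<^sup>2) =
      expectation (\<lambda>\<omega>. indicat_real B \<omega> * (S k \<omega>)\<^sup>2) + expectation (\<lambda>\<omega>. indicat_real B \<omega> * (d (m + k) \<omega>)\<^sup>2)"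
    if B: "B \<in> sets (F (m + k))" for B k
  proof -
    have [measurable]: "B \<in> sets M" using B F(1) by blast
    let ?G = "\<lambda>\<omega>. indicat_real B \<omega> * S k \<omega>"
    have G0: "expectation (\<lambda>\<omega>. ?G \<omega> * d (m + k) \<omega>) = 0"
    proof (rule orth)
      show "?G \<in> borel_measurable (F (m + k))" using B Sm[of k] by measurable
      show "\<exists>B. \<forall>\<omega>\<in>space M. \<bar>?G \<omega>\<bar> \<le> B"
        using BS[of _ k] by (intro exI[of _ "BS k"]) (force simp: indicator_def)
    qed
    have i1: "integrable M (\<lambda>\<omega>. ?G \<omega> * d (m + k) \<omega>)"
    proof (rule integrable_bounded[where B="BS k * Bd (m + k)"])
      fix \<omega> assume w: "\<omega> \<in> space M"
      have "\<bar>?G \<omega>\<bar> \<le> BS k" using BS[OF w, of k] by (auto simp: indicator_def)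
      then show "\<bar>?G \<omega> * d (m + k) \<omega>\<bar> \<le> BS k * Bd (m + k)"
        unfolding abs_mult[of "?G \<omega>"] using Bd[OF w] by (intro mult_mono) (auto intro: order_trans[OF abs_ge_zero])
    qed measurable
    have i2: "integrable M (\<lambda>\<omega>. indicat_real B \<omega> * (d (m + k) \<omega>)\<^sup>2)"
    proof (rule integrable_bounded[where B="(Bd (m + k))\<^sup>2"])
      fix \<omega> assume "\<omega> \<in> space M"
      then have "(d (m + k) \<omega>)\<^sup>2 \<le> (Bd (m + k))\<^sup>2"
        using order_trans[OF Bd abs_ge_self] by (intro abs_le_square_iff[THEN iffD1])
      then show "\<bar>indicat_real B \<omega> * (d (m + k) \<omega>)\<^sup>2\<bar> \<le> (Bd (m + k))\<^sup>2" by (auto simp: indicator_def)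
    qed measurable
    have "(\<lambda>\<omega>. indicat_real B \<omega> * (S (Suc k) \<omega>)\<^sup>2) = (\<lambda>\<omega>. indicat_real B \<omega> * (S k \<omega>)\<^sup>2 + 2 * (?G \<omega> * d (m + k) \<omega>)
       + indicat_real B \<omega> * (d (m + k) \<omega>)\<^sup>2)"
      by (simp add: step[symmetric] power2_sum algebra_simps)
    then show ?thesis using int2[of B k] i1 i2 G0 by simp
  qed
  have S2: "expectation (\<lambda>\<omega>. (S k \<omega>)\<^sup>2) = (\<Sum>i=m..<m+k. expectation (\<lambda>\<omega>. (d i \<omega>)\<^sup>2))" for k
  proof (induction k)
    case (Suc k)
    have "space M \<in> sets (F (m + k))" using F(2) sets.top[of "F (m + k)"] by simp
    from second[OF this] Suc show ?case
      by (simp cong: Bochner_Integration.integral_cong)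
  qed (simp add: S_def)
  \<comment> \<open>The submartingale property of the squared sums: on an event known at time m + k,
    each later difference adds a nonnegative second moment.\<close>
  have stop: "expectation (\<lambda>\<omega>. indicat_real (A k) \<omega> * (S k \<omega>)\<^sup>2) \<le> expectation (\<lambda>\<omega>. indicat_real (A k) \<omega> * (S n \<omega>)\<^sup>2)"
    if "k \<le> n" for k
    using that
  proof (induction n rule: dec_induct)
    case (step n)
    have "A k \<in> sets (F (m + n))" using AF Fmono[of "m + k" "m + n"] step by auto
    from second[OF this] step.IH show ?case
      by (simp add: add_increasing2)
  qed simp
  have Aprob: "e\<^sup>2 * prob (A k) \<le> expectation (\<lambda>\<omega>. indicat_real (A k) \<omega> * (S k \<omega>)\<^sup>2)" for k
  proof -
    have "e\<^sup>2 * prob (A k) = expectation (\<lambda>\<omega>. indicat_real (A k) \<omega> * e\<^sup>2)"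
      by simp
    also have "\<dots> \<le> expectation (\<lambda>\<omega>. indicat_real (A k) \<omega> * (S k \<omega>)\<^sup>2)"
    proof (rule integral_mono)
      show "integrable M (\<lambda>\<omega>. indicat_real (A k) \<omega> * e\<^sup>2)" 
        by (intro integrable_bounded[where B="e\<^sup>2"]) (auto simp: indicator_def)
      show "integrable M (\<lambda>\<omega>. indicat_real (A k) \<omega> * (S k \<omega>)\<^sup>2)" by (rule int2) measurable
      show "indicat_real (A k) \<omega> * e\<^sup>2 \<le> indicat_real (A k) \<omega> * (S k \<omega>)\<^sup>2" for \<omega>
        using e by (auto simp: indicator_def A_def abs_le_square_iff[symmetric])
    qed
    finally show ?thesis .
  qed
  have disj: "disjoint_family_on A {..n}"
    unfolding disjoint_family_on_def A_def by (auto, metis leD linorder_neqE_nat)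
  have ev: "{\<omega>\<in>space M. \<exists>k\<le>n. e < \<bar>S k \<omega>\<bar>} = (\<Union>k\<in>{..n}. A k)"
  proof (intro equalityI subsetI)
    fix \<omega> assume "\<omega> \<in> {\<omega>\<in>space M. \<exists>k\<le>n. e < \<bar>S k \<omega>\<bar>}"
    then obtain k where k: "k \<le> n" "e < \<bar>S k \<omega>\<bar>" and w: "\<omega> \<in> space M" by auto
    define l where "l = (LEAST j. e < \<bar>S j \<omega>\<bar>)"
    have "e < \<bar>S l \<omega>\<bar>" "l \<le> k" using k(2) unfolding l_def by (auto intro: LeastI Least_le)
    moreover have "\<bar>S j \<omega>\<bar> \<le> e" if "j < l" for j
      using not_less_Least[OF that[unfolded l_def]] by simp
    ultimately show "\<omega> \<in> (\<Union>k\<in>{..n}. A k)" using k w by (auto simp: A_def intro!: bexI[of _ l])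
  qed (auto simp: A_def)
  have "e\<^sup>2 * prob {\<omega>\<in>space M. \<exists>k\<le>n. e < \<bar>S k \<omega>\<bar>} = (\<Sum>k\<le>n. e\<^sup>2 * prob (A k))"
    unfolding ev by (subst finite_measure_finite_Union) (auto simp: disj sum_distrib_left)
  also have "\<dots> \<le> (\<Sum>k\<le>n. expectation (\<lambda>\<omega>. indicat_real (A k) \<omega> * (S n \<omega>)\<^sup>2))"
    by (intro sum_mono order_trans[OF Aprob stop]) auto
  also have "\<dots> = expectation (\<lambda>\<omega>. \<Sum>k\<le>n. indicat_real (A k) \<omega> * (S n \<omega>)\<^sup>2)"
    by (intro Bochner_Integration.integral_sum[symmetric] int2) measurable
  also have "\<dots> \<le> expectation (\<lambda>\<omega>. (S n \<omega>)\<^sup>2)"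
  proof (rule integral_mono)
    show "integrable M (\<lambda>\<omega>. \<Sum>k\<le>n. indicat_real (A k) \<omega> * (S n \<omega>)\<^sup>2)"
      by (intro Bochner_Integration.integrable_sum int2) measurable
    show "integrable M (\<lambda>\<omega>. (S n \<omega>)\<^sup>2)"
      using int2[of "space M" n] by (simp cong: Bochner_Integration.integrable_cong)
    have "(\<Sum>k\<le>n. indicat_real (A k) \<omega>) = indicat_real (\<Union>k\<in>{..n}. A k) \<omega>" for \<omega>
      by (simp add: indicator_UN_disjoint[OF _ disj])
    then show "(\<Sum>k\<le>n. indicat_real (A k) \<omega> * (S n \<omega>)\<^sup>2) \<le> (S n \<omega>)\<^sup>2" for \<omega>
      by (simp add: sum_distrib_right[symmetric] indicator_def)
  qed
  also have "\<dots> = (\<Sum>i=m..<m+n. expectation (\<lambda>\<omega>. (d i \<omega>)\<^sup>2))" by (rule S2)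
  finally show ?thesis using e unfolding S_def by (simp add: field_simps)
qed

text \<open>The maximal inequality bounds the oscillation after m by the variance tail, uniformly in
  the horizon n, so continuity from below gives the infinite-horizon event \<open>U e m\<close>. The
  tail vanishes as m grows, hence almost every path of partial sums is Cauchy.\<close>

lemma martingale_differences_summable:
  fixes d :: "nat \<Rightarrow> 'a \<Rightarrow> real" and F :: "nat \<Rightarrow> 'a measure"
  assumes F: "\<And>n. sets (F n) \<subseteq> sets M" "\<And>n. space (F n) = space M" "\<And>n. sets (F n) \<subseteq> sets (F (Suc n))"
    and meas: "\<And>n. d n \<in> borel_measurable (F (Suc n))"
    and bdd: "\<And>n. \<exists>B. \<forall>\<omega>\<in>space M. \<bar>d n \<omega>\<bar> \<le> B"
    and orth: "\<And>n G. G \<in> borel_measurable (F n) \<Longrightarrow> (\<exists>B. \<forall>\<omega>\<in>space M. \<bar>G \<omega>\<bar> \<le> B) \<Longrightarrow>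
        expectation (\<lambda>\<omega>. G \<omega> * d n \<omega>) = 0"
    and var: "summable (\<lambda>n. expectation (\<lambda>\<omega>. (d n \<omega>)\<^sup>2))"
  shows "AE \<omega> in M. summable (\<lambda>n. d n \<omega>)"
proof -
  let ?v = "\<lambda>n. expectation (\<lambda>\<omega>. (d n \<omega>)\<^sup>2)"
  have [measurable]: "d i \<in> borel_measurable M" for i
    using meas[of i] F(1)[of "Suc i"] F(2)[of "Suc i"] by (auto simp: measurable_def)
  define E where "E e m n = {\<omega>\<in>space M. \<exists>k\<le>n. e < \<bar>\<Sum>i=m..<m+k. d i \<omega>\<bar>}" for e :: real and m n
  define U where "U e m = {\<omega>\<in>space M. \<exists>k. e < \<bar>\<Sum>i=m..<m+k. d i \<omega>\<bar>}" for e :: real and m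
  have [measurable]: "E e m n \<in> sets M" "U e m \<in> sets M" for e m n unfolding E_def U_def by measurable
  have U: "prob (U e m) \<le> (\<Sum>i. ?v (i + m)) / e\<^sup>2" if e: "e > 0" for e m
  proof -
    have "(\<lambda>n. prob (E e m n)) \<longlonglongrightarrow> prob (\<Union>n. E e m n)"
      by (intro finite_Lim_measure_incseq) (auto simp: incseq_def E_def intro: order_trans)
    moreover have "(\<Union>n. E e m n) = U e m" by (auto simp: E_def U_def)
    moreover have "prob (E e m n) \<le> (\<Sum>i. ?v (i + m)) / e\<^sup>2" for n
    proof -
      have "prob (E e m n) \<le> (\<Sum>i=m..<m+n. ?v i) / e\<^sup>2"
        unfolding E_def by (rule kolmogorov_maximal_inequality[where d=d and F=F, OF F meas bdd orth e])
      also have "(\<Sum>i=m..<m+n. ?v i) = (\<Sum>i<n. ?v (i + m))"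
        using sum.shift_bounds_nat_ivl[of ?v 0 m n] by (simp add: atLeast0LessThan add.commute)
      also have "\<dots> \<le> (\<Sum>i. ?v (i + m))"
        using summable_ignore_initial_segment[OF var, of m] by (intro sum_le_suminf) auto
      finally show ?thesis by (simp add: divide_right_mono)
    qed
    ultimately show ?thesis by (auto intro: LIMSEQ_le_const2)
  qed
  have tail: "(\<lambda>m. \<Sum>i. ?v (i + m)) \<longlonglongrightarrow> 0"
    by (rule suminf_exist_split2[OF var])
  have null: "AE \<omega> in M. \<exists>m. \<omega> \<notin> U e m" if e: "e > 0" for e
  proof -
    have "(\<lambda>m. (\<Sum>i. ?v (i + m)) / e\<^sup>2) \<longlonglongrightarrow> 0" using tendsto_divide_zero[OF tail] by simp
    moreover have "prob (\<Inter>m. U e m) \<le> (\<Sum>i. ?v (i + m)) / e\<^sup>2" for m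
      by (rule order_trans[OF finite_measure_mono U[OF e]]) auto
    ultimately have "prob (\<Inter>m. U e m) \<le> 0" by (intro LIMSEQ_le_const) auto
    then have "(\<Inter>m. U e m) \<in> null_sets M"
      by (intro null_setsI) (auto simp: emeasure_eq_measure measure_le_0_iff)
    from AE_not_in[OF this] show ?thesis by eventually_elim auto
  qed
  have "AE \<omega> in M. \<forall>j::nat. \<exists>m. \<omega> \<notin> U (1 / Suc j) m"
    unfolding AE_all_countable using null by auto
  then show ?thesis using AE_space
  proof eventually_elim
    case (elim \<omega>)
    show ?case unfolding summable_Cauchy
    proof (intro allI impI)
      fix e :: real assume "e > 0"
      then have "e / 2 > 0" by simp
      then obtain j where j: "1 / Suc j < e / 2" using nat_approx_posE by blast
      obtain N where "\<omega> \<notin> U (1 / Suc j) N" using elim by blast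
      then have N: "\<bar>\<Sum>i=N..<N+k. d i \<omega>\<bar> \<le> 1 / Suc j" for k
        using elim by (auto simp: U_def not_less)
      have "norm (\<Sum>i=m..<n. d i \<omega>) < e" if "m \<ge> N" for m n
      proof (cases "m \<le> n")
        case True
        have "(\<Sum>i=m..<n. d i \<omega>) = (\<Sum>i=N..<N+(n-N). d i \<omega>) - (\<Sum>i=N..<N+(m-N). d i \<omega>)"
          using sum_diff_nat_ivl[of N m n "\<lambda>i. d i \<omega>"] True that by simp
        also have "norm \<dots> \<le> 1 / Suc j + 1 / Suc j"
          unfolding real_norm_def using N by (intro order_trans[OF abs_triangle_ineq4] add_mono)
        finally show ?thesis using j by simp
      qed (use \<open>e > 0\<close> in simp)
      then show "\<exists>N. \<forall>m\<ge>N. \<forall>n. norm (\<Sum>i=m..<n. d i \<omega>) < e" by blast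
    qed
  qed
qed

end

section \<open>Independence and filtration\<close>

context prob_space
begin

text \<open>The comprehension yields the whole space for empty J, whereas an empty intersection
  would be \<open>UNIV\<close>. Events that involve only some of the three sequences therefore need
  no separate treatment later.\<close>

lemma indep_sets_prob_Collect:
  assumes "indep_sets F I" "J \<subseteq> I" "finite J" "\<And>j. j \<in> J \<Longrightarrow> A j \<in> F j"
  shows "prob {\<omega>\<in>space M. \<forall>j\<in>J. \<omega> \<in> A j} = (\<Prod>j\<in>J. prob (A j))"
proof (cases "J = {}")
  case True
  then show ?thesis by (simp add: prob_space)
next
  case False
  have "F j \<subseteq> sets M" if "j \<in> J" for j
    using assms(1,2) that unfolding indep_sets_def by blast
  then have "A j \<subseteq> space M" if "j \<in> J" for j
    using assms(4)[OF that] that sets.sets_into_space by blast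
  then have "{\<omega>\<in>space M. \<forall>j\<in>J. \<omega> \<in> A j} = (\<Inter>j\<in>J. A j)" using False by auto
  then show ?thesis using indep_setsD[OF assms(1,2) False assms(3)] assms(4) by auto
qed

end

text \<open>Lets finite cylinder events of one sequence be fed into \<open>sequences_indep\<close>,
  which speaks of the sigma-algebras of whole sequences.\<close>

lemma generated_events_Collect:
  assumes Y: "\<And>i. i \<in> I \<Longrightarrow> Y i \<in> measurable M N"
    and J: "J \<subseteq> I" "finite J" and A: "\<And>k. k \<in> J \<Longrightarrow> \<exists>S\<in>sets N. A k = Y k -` S \<inter> space M"
  shows "{\<omega>\<in>space M. \<forall>k\<in>J. \<omega> \<in> A k} \<in> generated_events M N Y I"
proof -
  let ?V = "vimage_algebra (space M) (\<lambda>\<omega>. \<lambda>i\<in>I. Y i \<omega>) (PiM I (\<lambda>_. N))"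
  have "(\<lambda>\<omega>. \<lambda>i\<in>I. Y i \<omega>) \<in> measurable ?V (PiM I (\<lambda>_. N))"
    using measurable_space[OF Y] by (intro measurable_vimage_algebra1) (auto simp: space_PiM)
  then have "(\<lambda>\<omega>. (\<lambda>i\<in>I. Y i \<omega>) k) \<in> measurable ?V N" if "k \<in> I" for k
    by (rule measurable_compose[OF _ measurable_component_singleton[OF that]])
  then have V: "Y k \<in> measurable ?V N" if "k \<in> I" for k
    using that by (auto cong: measurable_cong)
  have "{\<omega>\<in>space ?V. \<forall>k\<in>J. \<omega> \<in> A k} \<in> sets ?V"
  proof (rule sets.sets_Collect_finite_All[OF _ J(2)])
    fix k assume k: "k \<in> J"
    from A[OF this] obtain S where S: "S \<in> sets N" "A k = Y k -` S \<inter> space M" by blast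
    have "{\<omega>\<in>space ?V. \<omega> \<in> A k} = Y k -` S \<inter> space ?V" using S by auto
    then show "{\<omega>\<in>space ?V. \<omega> \<in> A k} \<in> sets ?V"
      using measurable_sets[OF V S(1)] k J by auto
  qed
  then show ?thesis by (simp add: generated_events_def)
qed

context srrw_rvm
begin

abbreviation (input) X :: "nat \<Rightarrow> 'a \<Rightarrow> real" where
  "X \<equiv> srrw_step \<xi> \<alpha> \<beta>"

lemma mu_pos: "k \<ge> 1 \<Longrightarrow> \<mu> k > 0"
  using mu_regularly_varying by (auto simp: regularly_varying_seq_def)

lemma nu_pos: "k \<ge> 1 \<Longrightarrow> memory_sum \<mu> k > 0"
  unfolding memory_sum_def by (intro sum_pos) (auto simp: mu_pos)

lemma xi_measurable [measurable]: "n \<ge> 1 \<Longrightarrow> \<xi> n \<in> borel_measurable M"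
  using xi_indep by (auto simp: indep_vars_def2)

lemma alpha_measurable [measurable]: "n \<ge> 2 \<Longrightarrow> \<alpha> n \<in> measurable M (count_space UNIV)"
  using alpha_indep by (auto simp: indep_vars_def2)

lemma beta_measurable [measurable]: "n \<ge> 2 \<Longrightarrow> \<beta> n \<in> measurable M (count_space UNIV)"
  using beta_indep by (auto simp: indep_vars_def2)

text \<open>A pair (i, n) names the n-th variable of the sequence i, with 0, 1, 2 for
  \<open>\<xi>\<close>, \<open>\<alpha>\<close>, \<open>\<beta>\<close>. The common index set turns
  all independence hypotheses into the single statement \<open>indep_event_class\<close>.\<close>

definition event_class :: "nat \<times> nat \<Rightarrow> 'a set set" where
  "event_class = (\<lambda>(i, n).
     if i = 0 then {\<xi> n -` A \<inter> space M |A. A \<in> sets borel}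
     else if i = 1 then {\<alpha> n -` A \<inter> space M |A. A \<in> sets (count_space UNIV)}
     else {\<beta> n -` A \<inter> space M |A. A \<in> sets (count_space UNIV)})"

definition event_index :: "(nat \<times> nat) set" where
  "event_index = {0} \<times> {1..} \<union> {1, 2} \<times> {2..}"

lemma event_class_subset: "j \<in> event_index \<Longrightarrow> event_class j \<subseteq> sets M"
  by (auto simp: event_index_def event_class_def intro!: measurable_sets[OF xi_measurable]
      measurable_sets[OF alpha_measurable] measurable_sets[OF beta_measurable])

text \<open>Two layers are multiplied out. The finite set J splits into fibres \<open>K i\<close>,
  one for each sequence; \<open>sequences_indep\<close> factors across the joint events
  \<open>B i\<close>, and independence inside each sequence factors every
  \<open>B i\<close>.\<close>

lemma indep_event_class: "indep_sets event_class event_index"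
proof (rule indep_setsI)
  show "event_class j \<subseteq> events" if "j \<in> event_index" for j
    by (rule event_class_subset[OF that])
next
  fix A J
  assume J: "J \<noteq> {}" "J \<subseteq> event_index" "finite J" and A: "\<forall>j\<in>J. A j \<in> event_class j"
  define K where "K i = {k. (i, k) \<in> J}" for i
  have JK: "J = Sigma {0, 1, 2} K" using J(2) by (auto simp: K_def event_index_def)
  have fin: "finite (K i)" for i
    using finite_imageI[OF J(3), of snd] by (rule rev_finite_subset) (force simp: K_def)
  have K0: "K 0 \<subseteq> {1..}" and K1: "K 1 \<subseteq> {2..}" and K2: "K 2 \<subseteq> {2..}"
    using J(2) by (auto simp: K_def event_index_def)
  define B where "B i = {\<omega>\<in>space M. \<forall>k\<in>K i. \<omega> \<in> A (i, k)}" for i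
  have A0: "A (0, k) \<in> {\<xi> k -` S \<inter> space M |S. S \<in> sets borel}" if "k \<in> K 0" for k
    using A that by (auto simp: K_def event_class_def)
  have A1: "A (1, k) \<in> {\<alpha> k -` S \<inter> space M |S. S \<in> sets (count_space UNIV)}" if "k \<in> K 1" for k
    using A that by (auto simp: K_def event_class_def)
  have A2: "A (2, k) \<in> {\<beta> k -` S \<inter> space M |S. S \<in> sets (count_space UNIV)}" if "k \<in> K 2" for k
    using A that by (auto simp: K_def event_class_def)
  have B0: "prob (B 0) = (\<Prod>k\<in>K 0. prob (A (0, k)))"
    unfolding B_def using xi_indep[unfolded indep_vars_def2]
    by (intro indep_sets_prob_Collect[OF _ K0 fin A0]) auto
  have B1: "prob (B 1) = (\<Prod>k\<in>K 1. prob (A (1, k)))"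
    unfolding B_def using alpha_indep[unfolded indep_vars_def2]
    by (intro indep_sets_prob_Collect[OF _ K1 fin A1]) auto
  have B2: "prob (B 2) = (\<Prod>k\<in>K 2. prob (A (2, k)))"
    unfolding B_def using beta_indep[unfolded indep_vars_def2]
    by (intro indep_sets_prob_Collect[OF _ K2 fin A2]) auto
  have "B 0 \<in> generated_events M borel \<xi> {1..}"
    unfolding B_def using A0 K0 by (intro generated_events_Collect[OF _ K0 fin]) (auto, blast)
  moreover have "B 1 \<in> generated_events M (count_space UNIV) \<alpha> {2..}"
    unfolding B_def using A1 by (intro generated_events_Collect[OF _ K1 fin]) auto
  moreover have "B 2 \<in> generated_events M (count_space UNIV) \<beta> {2..}"
    unfolding B_def using A2 by (intro generated_events_Collect[OF _ K2 fin]) auto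
  ultimately have "prob (\<Inter>i\<in>{0,1,2}. B i) = (\<Prod>i\<in>{0,1,2}. prob (B i))"
    by (intro indep_setsD[OF sequences_indep]) auto
  also have "(\<Inter>i\<in>{0,1,2}. B i) = (\<Inter>j\<in>J. A j)"
  proof -
    have "A j \<subseteq> space M" if "j \<in> J" for j
      using A event_class_subset[of j] that J(2) sets.sets_into_space[of "A j" M] by blast
    then have "(\<Inter>j\<in>J. A j) = {\<omega>\<in>space M. \<forall>j\<in>J. \<omega> \<in> A j}" using J(1) by blast
    moreover have "(\<Inter>i\<in>{0,1,2}. B i) = {\<omega>\<in>space M. \<forall>j\<in>J. \<omega> \<in> A j}"
      unfolding B_def by (auto simp: JK)
    ultimately show ?thesis by simp
  qed
  also have "(\<Prod>i\<in>{0,1,2}. prob (B i)) = (\<Prod>i\<in>{0,1,2}. \<Prod>k\<in>K i. prob (A (i, k)))"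
    using B0 B1 B2 by simp
  also have "\<dots> = (\<Prod>j\<in>J. prob (A j))"
    unfolding JK by (subst prod.Sigma) (auto simp: fin)
  finally show "prob (\<Inter>j\<in>J. A j) = (\<Prod>j\<in>J. prob (A j))" .
qed

text \<open>Stability under intersection lifts independence from these generators to the
  sigma-algebras generated by groups of them.\<close>

lemma Int_stable_event_class: "Int_stable (event_class j)"
proof -
  have *: "Int_stable {f -` A \<inter> space M |A. A \<in> sets N}" for f :: "'a \<Rightarrow> 'c" and N :: "'c measure"
  proof (rule Int_stableI)
    fix a b assume "a \<in> {f -` A \<inter> space M |A. A \<in> sets N}" "b \<in> {f -` A \<inter> space M |A. A \<in> sets N}"
    then obtain A B where "A \<in> sets N" "B \<in> sets N" "a \<inter> b = f -` (A \<inter> B) \<inter> space M" by auto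
    then show "a \<inter> b \<in> {f -` A \<inter> space M |A. A \<in> sets N}" by blast
  qed
  show ?thesis unfolding event_class_def by (simp only: split: prod.split if_split) (intro allI impI conjI *)
qed

section \<open>The filtration of the three sequences\<close>

definition past :: "nat \<Rightarrow> (nat \<times> nat) set" where
  "past n = event_index \<inter> {(i, k). k \<le> n}"

definition filtration :: "nat \<Rightarrow> 'a measure" where
  "filtration n = sigma (space M) (\<Union>j\<in>past n. event_class j)"

lemma past_classes_subset: "(\<Union>j\<in>past n. event_class j) \<subseteq> Pow (space M)"
proof (intro UN_least subsetI PowI)
  fix j E \<omega> assume "j \<in> past n" "E \<in> event_class j" "\<omega> \<in> E"
  then show "\<omega> \<in> space M"
    using event_class_subset[of j] sets.sets_into_space[of E M] by (auto simp: past_def)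
qed

lemma space_filtration [simp]: "space (filtration n) = space M"
  by (simp add: filtration_def space_measure_of[OF past_classes_subset])

lemma sets_filtration: "sets (filtration n) = sigma_sets (space M) (\<Union>j\<in>past n. event_class j)"
  by (simp add: filtration_def sets_measure_of[OF past_classes_subset])

lemma filtration_subset: "sets (filtration n) \<subseteq> sets M"
  unfolding sets_filtration
  by (intro sets.sigma_sets_subset UN_least event_class_subset) (simp add: past_def)

lemma filtration_mono: "m \<le> n \<Longrightarrow> sets (filtration m) \<subseteq> sets (filtration n)"
  unfolding sets_filtration by (intro sigma_sets_mono') (auto simp: past_def)

lemma measurable_filtration_mono:
  "f \<in> measurable (filtration m) N \<Longrightarrow> m \<le> n \<Longrightarrow> f \<in> measurable (filtration n) N"
  using filtration_mono[of m n] by (auto simp: measurable_def)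

lemma measurable_filtration_M: "f \<in> measurable (filtration m) N \<Longrightarrow> f \<in> measurable M N"
  using filtration_subset[of m] by (auto simp: measurable_def)

lemma event_class_filtration: "j \<in> past n \<Longrightarrow> E \<in> event_class j \<Longrightarrow> E \<in> sets (filtration n)"
  unfolding sets_filtration by (rule sigma_sets.Basic) blast

lemma xi_filtration: "1 \<le> k \<Longrightarrow> k \<le> n \<Longrightarrow> \<xi> k \<in> borel_measurable (filtration n)"
  by (rule measurableI, simp, rule event_class_filtration[of "(0, k)"])
    (auto simp: past_def event_index_def event_class_def)

lemma alpha_filtration: "2 \<le> k \<Longrightarrow> k \<le> n \<Longrightarrow> \<alpha> k \<in> measurable (filtration n) (count_space UNIV)"
  by (rule measurableI, simp, rule event_class_filtration[of "(1, k)"])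
    (auto simp: past_def event_index_def event_class_def)

lemma beta_filtration: "2 \<le> k \<Longrightarrow> k \<le> n \<Longrightarrow> \<beta> k \<in> measurable (filtration n) (count_space UNIV)"
  by (rule measurableI, simp, rule event_class_filtration[of "(2, k)"])
    (auto simp: past_def event_index_def event_class_def)

text \<open>The random index is unfolded into a sum over its values, so that every summand is a
  product of a factor from the past and separate factors in \<open>\<alpha>\<close>,
  \<open>\<beta>\<close>, \<open>\<xi>\<close> at time \<open>Suc n\<close>. The last term records
  the default value 0 of a remembered step whose index is out of range.\<close>

lemma step_decompose:
  assumes "n \<ge> 1"
  shows "h (X (Suc n) \<omega>) =
    (\<Sum>j=1..n. h (X j \<omega>) * of_bool (\<alpha> (Suc n) \<omega>) * of_bool (\<beta> (Suc n) \<omega> = j))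
    + of_bool (\<not> \<alpha> (Suc n) \<omega>) * h (\<xi> (Suc n) \<omega>)
    + h 0 * of_bool (\<alpha> (Suc n) \<omega>) * (of_bool (\<beta> (Suc n) \<omega> \<notin> {1..n}) :: real)"
proof -
  obtain m where m: "n = Suc m" using assms by (cases n) auto
  have "(\<Sum>j=1..n. h (X j \<omega>) * of_bool (\<beta> (Suc n) \<omega> = j)) =
      (if \<beta> (Suc n) \<omega> \<in> {1..n} then h (X (\<beta> (Suc n) \<omega>) \<omega>) else 0)"
    by (subst sum.delta'[symmetric]) (auto intro!: sum.cong)
  then show ?thesis by (cases "\<alpha> (Suc n) \<omega>") (auto simp: m)
qed

lemma step_filtration: "k \<le> n \<Longrightarrow> X k \<in> borel_measurable (filtration n)"
proof (induction k arbitrary: n rule: less_induct)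
  case (less k)
  consider "k = 0" | "k = 1" | m where "k = Suc m" "m \<ge> 1" by (cases "k \<le> 1") (force, metis Suc_le_D Suc_le_mono One_nat_def not_less_eq_eq)
  then show ?case
  proof cases
    case 2
    have "X 1 = \<xi> 1" by (auto simp: fun_eq_iff)
    then show ?thesis using less.prems 2 xi_filtration[of 1 n] by simp
  next
    case 3
    have [measurable]: "X j \<in> borel_measurable (filtration n)" if "j \<in> {1..m}" for j
      using that less 3 by auto
    have [measurable]: "\<alpha> (Suc m) \<in> measurable (filtration n) (count_space UNIV)"
      "\<beta> (Suc m) \<in> measurable (filtration n) (count_space UNIV)"
      "\<xi> (Suc m) \<in> borel_measurable (filtration n)"
      using 3 less.prems by (auto intro!: alpha_filtration beta_filtration xi_filtration)
    have *: "X (Suc m) = (\<lambda>\<omega>. (\<Sum>j=1..m. X j \<omega> * of_bool (\<alpha> (Suc m) \<omega>) * of_bool (\<beta> (Suc m) \<omega> = j))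
      + of_bool (\<not> \<alpha> (Suc m) \<omega>) * \<xi> (Suc m) \<omega>)"
      using step_decompose[OF 3(2), of "\<lambda>x. x"] by auto
    show ?thesis unfolding 3(1) * by measurable
  qed simp
qed

lemma step_measurable [measurable]: "X k \<in> borel_measurable M"
  using measurable_filtration_M[OF step_filtration[OF order_refl]] .

section \<open>One-step conditional expectations\<close>

text \<open>The past and the three variables at time \<open>Suc n\<close> occupy disjoint sets of
  indices of \<open>event_class\<close>, so they generate four independent sigma-algebras.\<close>

lemma block_independence:
  fixes G :: "'a \<Rightarrow> real" and f :: "bool \<Rightarrow> real" and g :: "nat \<Rightarrow> real" and h :: "real \<Rightarrow> real"
  assumes n: "n \<ge> 1"
    and G: "G \<in> borel_measurable (filtration n)" "\<And>\<omega>. \<omega> \<in> space M \<Longrightarrow> \<bar>G \<omega>\<bar> \<le> BG"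
    and f: "\<And>x. \<bar>f x\<bar> \<le> Bf" and g: "\<And>x. \<bar>g x\<bar> \<le> Bg"
    and h: "h \<in> borel_measurable borel" "\<And>x. \<bar>h x\<bar> \<le> Bh"
  shows "expectation (\<lambda>\<omega>. G \<omega> * f (\<alpha> (Suc n) \<omega>) * g (\<beta> (Suc n) \<omega>) * h (\<xi> (Suc n) \<omega>)) =
    expectation G * expectation (\<lambda>\<omega>. f (\<alpha> (Suc n) \<omega>)) * expectation (\<lambda>\<omega>. g (\<beta> (Suc n) \<omega>))
      * expectation (\<lambda>\<omega>. h (\<xi> (Suc n) \<omega>))"
proof -
  \<comment> \<open>Block 0 is the past; blocks 1, 2, 3 carry \<open>\<xi>\<close>,
    \<open>\<alpha>\<close>, \<open>\<beta>\<close>, whence the shift j - 1.\<close>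
  define I where "I j = (if j = 0 then past n else {(j - 1, Suc n)})" for j :: nat
  define N where "N j = (if j = 0 then borel else if j = 1 then borel else count_space UNIV)" for j :: nat
  define Y where "Y j = (if j = 0 then G else if j = 1 then (\<lambda>\<omega>. h (\<xi> (Suc n) \<omega>))
     else if j = 2 then (\<lambda>\<omega>. f (\<alpha> (Suc n) \<omega>)) else (\<lambda>\<omega>. g (\<beta> (Suc n) \<omega>)))" for j :: nat
  have gm: "g \<in> borel_measurable (count_space UNIV)" and fm: "f \<in> borel_measurable (count_space UNIV)" by auto
  have meas: "Y j \<in> borel_measurable M" if "j \<in> {0,1,2,3}" for j
    using that measurable_filtration_M[OF G(1)] n h(1)
      measurable_compose[OF xi_measurable[of "Suc n"] h(1)]
      measurable_compose[OF alpha_measurable[of "Suc n"] fm]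
      measurable_compose[OF beta_measurable[of "Suc n"] gm]
    by (auto simp: Y_def)
  have "indep_sets (\<lambda>j. sigma_sets (space M) (\<Union>i\<in>I j. event_class i)) {0,1,2,3}"
  proof (rule indep_sets_collect_sigma)
    show "indep_sets event_class (\<Union>j\<in>{0,1,2,3}. I j)"
      by (rule indep_sets_mono_index[OF _ indep_event_class])
        (use n in \<open>auto simp: I_def event_index_def past_def\<close>)
    show "disjoint_family_on I {0,1,2,3}"
      by (auto simp: disjoint_family_on_def I_def past_def)
  qed (rule Int_stable_event_class)
  then have "indep_sets (\<lambda>j. {Y j -` A \<inter> space M |A. A \<in> sets borel}) {0,1,2,3}"
  proof (rule indep_sets_mono_sets)
    fix j :: nat assume "j \<in> {0,1,2,3}"
    then consider "j = 0" | "j = 1" | "j = 2" | "j = 3" by auto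
    then show "{Y j -` A \<inter> space M |A. A \<in> sets borel} \<subseteq> sigma_sets (space M) (\<Union>i\<in>I j. event_class i)"
    proof cases
      case 1
      then show ?thesis
        using measurable_sets[OF G(1)] by (auto simp: Y_def I_def sets_filtration[symmetric])
    next
      case 2
      have "Y j -` A \<inter> space M \<in> event_class (0, Suc n)" if "A \<in> sets borel" for A
        using 2 measurable_sets[OF h(1) that]
        by (auto simp: Y_def event_class_def vimage_def intro!: exI[of _ "h -` A"])
      then show ?thesis using 2 by (auto simp: I_def)
    next
      case 3
      have "Y j -` A \<inter> space M \<in> event_class (1, Suc n)" if "A \<in> sets borel" for A
        using 3 by (auto simp: Y_def event_class_def vimage_def intro!: exI[of _ "f -` A"])
      then show ?thesis using 3 by (auto simp: I_def)
    next
      case 4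
      have "Y j -` A \<inter> space M \<in> event_class (2, Suc n)" if "A \<in> sets borel" for A
        using 4 by (auto simp: Y_def event_class_def vimage_def intro!: exI[of _ "g -` A"])
      then show ?thesis using 4 by (auto simp: I_def)
    qed
  qed
  then have indep: "indep_vars (\<lambda>_. borel) Y {0,1,2,3}"
    using meas unfolding indep_vars_def2 by auto
  have int: "integrable M (Y j)" if "j \<in> {0,1,2,3}" for j
    using that by (intro integrable_bounded[where B="max BG (max Bf (max Bg Bh))"] meas)
      (auto simp: Y_def intro: order_trans[OF G(2)] order_trans[OF f] order_trans[OF g] order_trans[OF h(2)])
  have "expectation (\<lambda>\<omega>. \<Prod>j\<in>{0,1,2,3}. Y j \<omega>) = (\<Prod>j\<in>{0,1,2,3}. expectation (Y j))"
    by (rule indep_vars_lebesgue_integral[OF _ indep int]) auto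
  then show ?thesis by (simp add: Y_def mult_ac)
qed

lemma expectation_alpha:
  assumes "n \<ge> 2"
  shows "expectation (\<lambda>\<omega>. of_bool (\<alpha> n \<omega>)) = p" "expectation (\<lambda>\<omega>. of_bool (\<not> \<alpha> n \<omega>)) = 1 - p"
proof -
  note [measurable] = alpha_measurable[OF assms]
  have "expectation (\<lambda>\<omega>. of_bool (\<alpha> n \<omega>) :: real) = (\<integral>x. of_bool x \<partial>distr M (count_space UNIV) (\<alpha> n))"
    using integral_distr[of "\<alpha> n" M "count_space UNIV" "of_bool :: bool \<Rightarrow> real"] by simp
  also have "\<dots> = p" unfolding alpha_distr[OF assms] using p_range by simp
  finally show *: "expectation (\<lambda>\<omega>. of_bool (\<alpha> n \<omega>)) = p" .
  have "(\<lambda>\<omega>. of_bool (\<not> \<alpha> n \<omega>) :: real) = (\<lambda>\<omega>. 1 - of_bool (\<alpha> n \<omega>))" by auto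
  moreover have "integrable M (\<lambda>\<omega>. of_bool (\<alpha> n \<omega>) :: real)"
    by (rule integrable_bounded[where B=1]) auto
  ultimately show "expectation (\<lambda>\<omega>. of_bool (\<not> \<alpha> n \<omega>)) = 1 - p"
    using * by (simp add: prob_space)
qed

lemma expectation_beta:
  assumes "n \<ge> 1" "j \<in> {1..n}"
  shows "expectation (\<lambda>\<omega>. of_bool (\<beta> (Suc n) \<omega> = j)) = \<mu> j / memory_sum \<mu> n"
proof -
  note [measurable] = beta_measurable[of "Suc n"]
  have "expectation (\<lambda>\<omega>. of_bool (\<beta> (Suc n) \<omega> = j)) =
      expectation (indicator {\<omega>\<in>space M. \<beta> (Suc n) \<omega> = j})"
    by (intro Bochner_Integration.integral_cong) (auto simp: indicator_def)
  also have "\<dots> = prob {\<omega>\<in>space M. \<beta> (Suc n) \<omega> = j}"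
    using assms by simp
  finally show ?thesis using beta_distr[of "Suc n" j] assms by simp
qed

text \<open>Only the point masses at 1, ..., n are prescribed, but the normalisation by
  \<open>memory_sum \<mu> n\<close> makes them add up to 1.\<close>

lemma expectation_beta_outside:
  assumes "n \<ge> 1"
  shows "expectation (\<lambda>\<omega>. of_bool (\<beta> (Suc n) \<omega> \<notin> {1..n})) = (0 :: real)"
proof -
  note [measurable] = beta_measurable[of "Suc n"]
  define b where "b j \<omega> = (of_bool (\<beta> (Suc n) \<omega> = j) :: real)" for j \<omega>
  have int: "integrable M (b j)" for j
    unfolding b_def using assms by (intro integrable_bounded[where B=1]) auto
  have "(\<lambda>\<omega>. of_bool (\<beta> (Suc n) \<omega> \<notin> {1..n}) :: real) = (\<lambda>\<omega>. 1 - (\<Sum>j=1..n. b j \<omega>))"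
    by (auto simp: fun_eq_iff of_bool_def b_def)
  then have "expectation (\<lambda>\<omega>. of_bool (\<beta> (Suc n) \<omega> \<notin> {1..n})) = expectation (\<lambda>\<omega>. 1 - (\<Sum>j=1..n. b j \<omega>))"
    by (rule arg_cong)
  also have "\<dots> = 1 - (\<Sum>j=1..n. expectation (b j))"
    using int by (simp add: prob_space)
  also have "(\<Sum>j=1..n. expectation (b j)) = (\<Sum>j=1..n. \<mu> j / memory_sum \<mu> n)"
    unfolding b_def using assms by (intro sum.cong expectation_beta) auto
  also have "\<dots> = 1"
    using nu_pos[OF assms] by (simp add: sum_divide_distrib[symmetric] memory_sum_def)
  finally show ?thesis by simp
qed

lemma expectation_xi:
  assumes "h \<in> borel_measurable borel" "n \<ge> 1"
  shows "expectation (\<lambda>\<omega>. h (\<xi> n \<omega>)) = (expectation (\<lambda>\<omega>. h (\<xi> 1 \<omega>)) :: real)"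
  using integral_distr[of "\<xi> n" M borel h] integral_distr[of "\<xi> 1" M borel h] xi_ident[of n] assms
  by simp

definition compensator :: "(real \<Rightarrow> real) \<Rightarrow> nat \<Rightarrow> 'a \<Rightarrow> real" where
  "compensator h n \<omega> = p * (\<Sum>j=1..n. \<mu> j / memory_sum \<mu> n * h (X j \<omega>))
     + (1 - p) * expectation (\<lambda>\<omega>. h (\<xi> 1 \<omega>))"

lemma compensator_filtration:
  "h \<in> borel_measurable borel \<Longrightarrow> compensator h n \<in> borel_measurable (filtration n)"
proof -
  assume [measurable]: "h \<in> borel_measurable borel"
  have [measurable]: "X j \<in> borel_measurable (filtration n)" if "j \<in> {1..n}" for j
    using that by (intro step_filtration) auto
  show ?thesis unfolding compensator_def[abs_def] by measurable
qed

lemma compensator_bounded: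
  assumes "\<And>x. \<bar>h x\<bar> \<le> B"
  shows "\<exists>B'. \<forall>\<omega>\<in>space M. \<bar>compensator h n \<omega>\<bar> \<le> B'"
proof (intro exI ballI)
  fix \<omega>
  have "\<bar>\<Sum>j=1..n. \<mu> j / memory_sum \<mu> n * h (X j \<omega>)\<bar> \<le> (\<Sum>j=1..n. \<bar>\<mu> j / memory_sum \<mu> n\<bar> * B)"
    by (intro order_trans[OF sum_abs] sum_mono, unfold abs_mult) (intro mult_left_mono assms abs_ge_zero)
  then show "\<bar>compensator h n \<omega>\<bar> \<le> \<bar>p\<bar> * (\<Sum>j=1..n. \<bar>\<mu> j / memory_sum \<mu> n\<bar> * B)
      + \<bar>(1 - p) * expectation (\<lambda>\<omega>. h (\<xi> 1 \<omega>))\<bar>"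
    unfolding compensator_def
    by (intro order_trans[OF abs_triangle_ineq] add_mono order_refl, unfold abs_mult)
      (intro mult_left_mono abs_ge_zero)
qed

text \<open>\<open>compensator h n\<close> is the conditional expectation of \<open>h (X (Suc n))\<close> given the past.\<close>

lemma expectation_step:
  fixes G :: "'a \<Rightarrow> real"
  assumes n: "n \<ge> 1"
    and G: "G \<in> borel_measurable (filtration n)" "\<And>\<omega>. \<omega> \<in> space M \<Longrightarrow> \<bar>G \<omega>\<bar> \<le> BG"
    and h: "h \<in> borel_measurable borel" "\<And>x. \<bar>h x\<bar> \<le> B"
  shows "expectation (\<lambda>\<omega>. G \<omega> * h (X (Suc n) \<omega>)) = expectation (\<lambda>\<omega>. G \<omega> * compensator h n \<omega>)"
proof -
  note [measurable] = h(1) measurable_filtration_M[OF G(1)]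
  have Sn: "Suc n \<ge> 2" "Suc n \<ge> 1" using n by auto
  note [measurable] = alpha_measurable[OF Sn(1)] beta_measurable[OF Sn(1)] xi_measurable[OF Sn(2)]
  have B0: "B \<ge> 0" using h(2)[of 0] by linarith
  have GX: "\<bar>G \<omega> * h (X j \<omega>)\<bar> \<le> BG * B" if "\<omega> \<in> space M" for j \<omega>
    unfolding abs_mult using G(2)[OF that] h(2) by (intro mult_mono) (auto intro: order_trans[OF abs_ge_zero])
  have GXm: "(\<lambda>\<omega>. G \<omega> * h (X j \<omega>)) \<in> borel_measurable (filtration n)" if "j \<le> n" for j
    using G(1) measurable_compose[OF step_filtration[OF that] h(1)] by (rule borel_measurable_times)
  \<comment> \<open>Each term is padded to one factor per block of
    \<open>block_independence\<close>: the final 1 in \<open>t1\<close> and the constant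
    \<open>h 0\<close> in \<open>t3\<close> stand for functions of \<open>\<xi>\<close>, the 1 in
    \<open>t2\<close> for a function of \<open>\<beta>\<close>.\<close>
  define t1 where "t1 j \<omega> = (G \<omega> * h (X j \<omega>)) * of_bool (\<alpha> (Suc n) \<omega>) * of_bool (\<beta> (Suc n) \<omega> = j) * 1" for j \<omega>
  define t2 where "t2 \<omega> = G \<omega> * of_bool (\<not> \<alpha> (Suc n) \<omega>) * 1 * h (\<xi> (Suc n) \<omega>)" for \<omega>
  define t3 where "t3 \<omega> = G \<omega> * of_bool (\<alpha> (Suc n) \<omega>) * (of_bool (\<beta> (Suc n) \<omega> \<notin> {1..n})) * h 0" for \<omega>
  have i1: "integrable M (t1 j)" for j
  proof (rule integrable_bounded[where B="BG * B"])
    show "\<bar>t1 j \<omega>\<bar> \<le> BG * B" if "\<omega> \<in> space M" for \<omega>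
      using GX[OF that, of j] abs_ge_zero order_trans by (fastforce simp: t1_def of_bool_def)
    show "t1 j \<in> borel_measurable M" unfolding t1_def[abs_def] by measurable
  qed
  have i2: "integrable M t2"
  proof (rule integrable_bounded[where B="BG * B"])
    show "\<bar>t2 \<omega>\<bar> \<le> BG * B" if "\<omega> \<in> space M" for \<omega>
    proof -
      have "\<bar>G \<omega>\<bar> * \<bar>h (\<xi> (Suc n) \<omega>)\<bar> \<le> BG * B"
        using G(2)[OF that] h(2) by (intro mult_mono) (auto intro: order_trans[OF abs_ge_zero])
      moreover have "0 \<le> BG * B" using G(2)[OF that] B0 by (intro mult_nonneg_nonneg) auto
      ultimately show ?thesis by (auto simp: t2_def of_bool_def abs_mult)
    qed
    show "t2 \<in> borel_measurable M" unfolding t2_def[abs_def] using Sn by measurable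
  qed
  have i3: "integrable M t3"
  proof (rule integrable_bounded[where B="BG * B"])
    show "\<bar>t3 \<omega>\<bar> \<le> BG * B" if "\<omega> \<in> space M" for \<omega>
    proof -
      have "\<bar>G \<omega>\<bar> * \<bar>h 0\<bar> \<le> BG * B"
        using G(2)[OF that] h(2) by (intro mult_mono) (auto intro: order_trans[OF abs_ge_zero])
      moreover have "0 \<le> BG * B" using G(2)[OF that] B0 by (intro mult_nonneg_nonneg) auto
      ultimately show ?thesis by (auto simp: t3_def of_bool_def abs_mult)
    qed
    show "t3 \<in> borel_measurable M" unfolding t3_def[abs_def] using Sn(1)
      by (intro borel_measurable_times borel_measurable_const measurable_filtration_M[OF G(1)]
          measurable_compose[OF alpha_measurable] measurable_compose[OF beta_measurable]) auto
  qed
  have e1: "expectation (t1 j) = expectation (\<lambda>\<omega>. G \<omega> * h (X j \<omega>)) * p * (\<mu> j / memory_sum \<mu> n)" if "j \<in> {1..n}" for j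
  proof -
    have "expectation (t1 j) = expectation (\<lambda>\<omega>. G \<omega> * h (X j \<omega>)) * expectation (\<lambda>\<omega>. of_bool (\<alpha> (Suc n) \<omega>))
        * expectation (\<lambda>\<omega>. of_bool (\<beta> (Suc n) \<omega> = j)) * expectation (\<lambda>\<omega>. 1)"
      unfolding t1_def[abs_def]
      by (rule block_independence[OF n GXm GX, where Bf=1 and Bg=1 and Bh=1]) (use that in auto)
    then show ?thesis using expectation_alpha(1)[OF Sn(1)] expectation_beta[OF n that] by (simp add: prob_space)
  qed
  have "expectation t2 = expectation G * expectation (\<lambda>\<omega>. of_bool (\<not> \<alpha> (Suc n) \<omega>))
      * expectation (\<lambda>\<omega>. 1) * expectation (\<lambda>\<omega>. h (\<xi> (Suc n) \<omega>))"
    unfolding t2_def[abs_def] t3_def[abs_def]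
    by (rule block_independence[OF n G, where Bf=1 and Bg=1 and Bh=B]) (auto simp: h)
  then have e2: "expectation t2 = expectation G * ((1 - p) * expectation (\<lambda>\<omega>. h (\<xi> 1 \<omega>)))"
    using expectation_alpha(2)[OF Sn(1)] expectation_xi[OF h(1) Sn(2)] by (simp add: prob_space)
  have "expectation t3 = expectation G * expectation (\<lambda>\<omega>. of_bool (\<alpha> (Suc n) \<omega>))
      * expectation (\<lambda>\<omega>. of_bool (\<beta> (Suc n) \<omega> \<notin> {1..n})) * expectation (\<lambda>\<omega>. h 0)"
    unfolding t2_def[abs_def] t3_def[abs_def]
    by (rule block_independence[OF n G, where Bf=1 and Bg=1 and Bh=B]) (auto simp: h)
  then have e3: "expectation t3 = 0"
    using expectation_beta_outside[OF n] by simp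
  have "(\<lambda>\<omega>. G \<omega> * h (X (Suc n) \<omega>)) = (\<lambda>\<omega>. (\<Sum>j=1..n. t1 j \<omega>) + t2 \<omega> + t3 \<omega>)"
  proof
    fix \<omega>
    have "h (X (Suc n) \<omega>) = (\<Sum>j=1..n. h (X j \<omega>) * of_bool (\<alpha> (Suc n) \<omega>) * of_bool (\<beta> (Suc n) \<omega> = j))
        + of_bool (\<not> \<alpha> (Suc n) \<omega>) * h (\<xi> (Suc n) \<omega>)
        + h 0 * of_bool (\<alpha> (Suc n) \<omega>) * of_bool (\<beta> (Suc n) \<omega> \<notin> {1..n})"
      by (rule step_decompose[OF n])
    moreover have "(\<Sum>j=1..n. t1 j \<omega>) =
        G \<omega> * (\<Sum>j=1..n. h (X j \<omega>) * of_bool (\<alpha> (Suc n) \<omega>) * of_bool (\<beta> (Suc n) \<omega> = j))"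
      unfolding sum_distrib_left t1_def by (intro sum.cong refl) simp
    ultimately show "G \<omega> * h (X (Suc n) \<omega>) = (\<Sum>j=1..n. t1 j \<omega>) + t2 \<omega> + t3 \<omega>"
      unfolding t2_def t3_def by (simp only: distrib_left mult_ac mult_1_left mult_1_right)
  qed
  then have "expectation (\<lambda>\<omega>. G \<omega> * h (X (Suc n) \<omega>)) = (\<Sum>j=1..n. expectation (t1 j)) + expectation t2 + expectation t3"
    using i1 i2 i3 by simp
  also have "\<dots> = (\<Sum>j=1..n. expectation (\<lambda>\<omega>. G \<omega> * h (X j \<omega>)) * p * (\<mu> j / memory_sum \<mu> n))
      + expectation G * ((1 - p) * expectation (\<lambda>\<omega>. h (\<xi> 1 \<omega>)))"
    using e1 e2 e3 by simp
  also have "\<dots> = expectation (\<lambda>\<omega>. (\<Sum>j=1..n. (G \<omega> * h (X j \<omega>)) * (p * (\<mu> j / memory_sum \<mu> n)))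
      + G \<omega> * ((1 - p) * expectation (\<lambda>\<omega>. h (\<xi> 1 \<omega>))))"
  proof -
    define Z where "Z j \<omega> = G \<omega> * h (X j \<omega>)" for j \<omega>
    define c where "c j = p * (\<mu> j / memory_sum \<mu> n)" for j
    have "integrable M (Z j)" for j
      unfolding Z_def[abs_def] by (rule integrable_bounded[OF _ GX]) auto
    moreover have "integrable M G" by (rule integrable_bounded[OF _ G(2)]) auto
    ultimately show ?thesis unfolding mult.assoc[of _ p] c_def[symmetric] Z_def[symmetric] by simp
  qed
  also have "\<dots> = expectation (\<lambda>\<omega>. G \<omega> * compensator h n \<omega>)"
    unfolding compensator_def by (intro Bochner_Integration.integral_cong) (auto simp: algebra_simps sum_distrib_left)
  finally show ?thesis .
qed

text \<open>Strong induction. With the constant test function 1 and an indicator h,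
  \<open>expectation_step\<close> shows the law of the next step to be a mixture of laws all equal
  to that of \<open>\<xi> 1\<close>, with weights of total mass 1.\<close>

lemma distr_step:
  assumes "n \<ge> 1"
  shows "distr M borel (X n) = distr M borel (\<xi> 1)"
  using assms
proof (induction n rule: less_induct)
  case (less n)
  show ?case
  proof (cases "n = 1")
    case True
    have "X 1 = \<xi> 1" by (auto simp: fun_eq_iff)
    then show ?thesis using True by simp
  next
    case False
    then obtain m where m: "n = Suc m" "m \<ge> 1" using less.prems by (cases n) auto
    show ?thesis
    proof (rule measure_eqI)
      fix A :: "real set" assume "A \<in> sets (distr M borel (X n))"
      then have A [measurable]: "A \<in> sets borel" by simp
      have pr: "expectation (\<lambda>\<omega>. indicat_real A (Z \<omega>)) = measure (distr M borel Z) A"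
        if [measurable]: "Z \<in> borel_measurable M" for Z :: "'a \<Rightarrow> real"
      proof -
        have "expectation (\<lambda>\<omega>. indicat_real A (Z \<omega>)) = (\<integral>x. indicat_real A x \<partial>distr M borel Z)"
          by (subst integral_distr) auto
        then show ?thesis by simp
      qed
      let ?q = "measure (distr M borel (\<xi> 1)) A"
      have "measure (distr M borel (X n)) A = expectation (\<lambda>\<omega>. 1 * indicat_real A (X (Suc m) \<omega>))"
        using pr[OF step_measurable[of n]] m by simp
      also have "\<dots> = expectation (\<lambda>\<omega>. 1 * compensator (indicat_real A) m \<omega>)"
        by (rule expectation_step[OF m(2), where BG=1 and B=1]) (auto simp: indicator_def)
      also have "\<dots> = p * (\<Sum>j=1..m. \<mu> j / memory_sum \<mu> m * ?q) + (1 - p) * ?q"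
      proof -
        have "expectation (\<lambda>\<omega>. indicat_real A (X j \<omega>)) = ?q" if "j \<in> {1..m}" for j
          using pr[OF step_measurable[of j]] less.IH[of j] that m by simp
        moreover have "integrable M (\<lambda>\<omega>. indicat_real A (X j \<omega>))" for j
          by (rule integrable_bounded[where B=1]) (auto simp: indicator_def)
        ultimately show ?thesis
          unfolding compensator_def using pr[OF xi_measurable[of 1]] by (simp add: prob_space)
      qed
      also have "\<dots> = ?q"
        using nu_pos[OF m(2)]
        by (simp add: sum_distrib_right[symmetric] sum_divide_distrib[symmetric] memory_sum_def algebra_simps)
      finally have "measure (distr M borel (X n)) A = ?q" .
      moreover have "emeasure (distr M borel Z) A = ennreal (measure (distr M borel Z) A)"
        if "Z \<in> borel_measurable M" for Z
        using prob_space_distr[OF that] by (simp add: finite_measure.emeasure_eq_measure prob_space.finite_measure)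
      ultimately show "emeasure (distr M borel (X n)) A = emeasure (distr M borel (\<xi> 1)) A"
        using xi_measurable[of 1] by simp
    qed simp
  qed
qed

end

section \<open>Almost sure convergence\<close>

text \<open>Large values are set to 0 rather than clipped to the level, so the terms with k < |x|
  drop out of \<open>sum_truncate_squares_le\<close>.\<close>

definition truncate :: "nat \<Rightarrow> real \<Rightarrow> real" where
  "truncate k x = (if \<bar>x\<bar> \<le> real k then x else 0)"

lemma truncate_measurable [measurable]: "truncate k \<in> borel_measurable borel"
  unfolding truncate_def[abs_def] by measurable

lemma abs_truncate_le: "\<bar>truncate k x\<bar> \<le> real k" "\<bar>truncate k x\<bar> \<le> \<bar>x\<bar>"
  by (auto simp: truncate_def)

text \<open>Telescoping of 1 / (k * (k + 1)). The subtracted term makes the induction close, and the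
  2 absorbs the first summand.\<close>

lemma sum_inverse_squares_le:
  assumes "1 \<le> m" "m \<le> n"
  shows "(\<Sum>k=m..n. 1 / (real k)\<^sup>2) \<le> 2 / real m - 1 / real n"
  using assms(2)
proof (induction n rule: dec_induct)
  case base
  have "1 / (real m)\<^sup>2 \<le> 1 / real m"
    using assms(1) by (intro divide_left_mono) (auto simp: power2_eq_square)
  then show ?case by simp
next
  case (step n)
  have n: "real n > 0" using step assms by simp
  have "1 / (real (Suc n))\<^sup>2 \<le> 1 / (real n * real (Suc n))"
    using n by (intro divide_left_mono) (auto simp: power2_eq_square intro!: mult_pos_pos)
  also have "\<dots> = 1 / real n - 1 / real (Suc n)" using n by (simp add: field_simps)
  finally show ?case using step by simp
qed

text \<open>The pathwise form of the estimate behind Kolmogorov's strong law: truncation kills all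
  terms below |x|, and the tail of 1 / k^2 from there is of order 1 / |x|. Taking expectations turns
  the first moment into a bound on the weighted truncated second moments.\<close>

lemma sum_truncate_squares_le: "(\<Sum>k=1..n. (truncate k x)\<^sup>2 / (real k)\<^sup>2) \<le> 2 * \<bar>x\<bar>"
proof -
  define m where "m = max 1 (nat \<lceil>\<bar>x\<bar>\<rceil>)"
  have m: "1 \<le> m" "\<bar>x\<bar> \<le> real m" unfolding m_def by linarith+
  have small: "truncate k x = 0" if "1 \<le> k" "k < m" for k
    using that by (auto simp: truncate_def m_def split: if_splits) linarith+
  have "(\<Sum>k=1..n. (truncate k x)\<^sup>2 / (real k)\<^sup>2) = (\<Sum>k=m..n. (truncate k x)\<^sup>2 / (real k)\<^sup>2)"
    using m by (intro sum.mono_neutral_right) (auto simp: small)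
  also have "\<dots> \<le> (\<Sum>k=m..n. x\<^sup>2 * (1 / (real k)\<^sup>2))"
    using abs_truncate_le(2) by (intro sum_mono) (auto simp: divide_right_mono abs_le_square_iff[symmetric])
  also have "\<dots> = x\<^sup>2 * (\<Sum>k=m..n. 1 / (real k)\<^sup>2)" by (simp only: sum_distrib_left)
  also have "\<dots> \<le> x\<^sup>2 * (2 / real m)"
  proof (cases "m \<le> n")
    case True
    then have "(\<Sum>k=m..n. 1 / (real k)\<^sup>2) \<le> 2 / real m"
      using order_trans[OF sum_inverse_squares_le[OF m(1) True]] by simp
    then show ?thesis by (intro mult_left_mono) auto
  qed simp
  also have "\<dots> = 2 * (\<bar>x\<bar> * (\<bar>x\<bar> / real m))" by (simp add: power2_eq_square)
  also have "\<dots> \<le> 2 * (\<bar>x\<bar> * 1)"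
    using m by (intro mult_left_mono) auto
  finally show ?thesis by simp
qed

text \<open>Its expectation bounds the sum of the tail probabilities P(Y > k) by E Y + 1.\<close>

lemma sum_indicator_less_le: "x \<ge> 0 \<Longrightarrow> (\<Sum>k<n. indicat_real {y. real k < y} x) \<le> x + 1"
proof -
  assume x: "x \<ge> 0"
  have "(\<Sum>k<n. indicat_real {y. real k < y} x) = (\<Sum>k\<in>{k. k < n \<and> real k < x}. 1)"
    by (intro sum.mono_neutral_cong_right) (auto simp: indicator_def)
  also have "\<dots> \<le> (\<Sum>k\<in>{..nat \<lfloor>x\<rfloor>}. 1)"
    by (intro sum_mono2) (auto simp: le_nat_floor)
  also have "\<dots> \<le> x + 1" using x by simp
  finally show ?thesis .
qed

context srrw_rvm
begin

section \<open>Consequences of the common law of the steps\<close>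

lemma integral_step:
  fixes h :: "real \<Rightarrow> real"
  assumes "h \<in> borel_measurable borel" "n \<ge> 1"
  shows "expectation (\<lambda>\<omega>. h (X n \<omega>)) = expectation (\<lambda>\<omega>. h (\<xi> 1 \<omega>))"
  using integral_distr[of "X n" M borel h] integral_distr[of "\<xi> 1" M borel h] distr_step[of n] assms
  by simp

lemma integrable_step_iff:
  fixes h :: "real \<Rightarrow> real"
  assumes "h \<in> borel_measurable borel" "n \<ge> 1"
  shows "integrable M (\<lambda>\<omega>. h (X n \<omega>)) \<longleftrightarrow> integrable M (\<lambda>\<omega>. h (\<xi> 1 \<omega>))"
  using integrable_distr_eq[of "X n" M borel h] integrable_distr_eq[of "\<xi> 1" M borel h] distr_step[of n] assms
  by simp

text \<open>The steps are dependent, but the convergent half of Borel-Cantelli asks only for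
  summable probabilities, and these depend on the common law alone.\<close>

lemma AE_step_le_index: "AE \<omega> in M. \<forall>\<^sub>F n in sequentially. \<bar>X n \<omega>\<bar> \<le> real n"
proof -
  define A where "A n = {\<omega>\<in>space M. real n < \<bar>X n \<omega>\<bar>}" for n
  have [measurable]: "A n \<in> sets M" for n unfolding A_def by measurable
  define q where "q n = expectation (\<lambda>\<omega>. indicat_real {y. real n < y} \<bar>\<xi> 1 \<omega>\<bar>)" for n
  have prob_A: "prob (A n) = q n" if "n \<ge> 1" for n
  proof -
    have "prob (A n) = expectation (indicat_real (A n))" by simp
    also have "\<dots> = expectation (\<lambda>\<omega>. indicat_real {y. real n < y} \<bar>X n \<omega>\<bar>)"
      by (intro Bochner_Integration.integral_cong) (auto simp: A_def indicator_def)
    also have "\<dots> = q n"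
      unfolding q_def by (rule integral_step[OF _ that]) measurable
    finally show ?thesis .
  qed
  have "summable q"
  proof (rule summableI_nonneg_bounded)
    show "0 \<le> q n" for n unfolding q_def by simp
    fix n
    have int: "integrable M (\<lambda>\<omega>. indicat_real {y. real k < y} \<bar>\<xi> 1 \<omega>\<bar>)" for k
      by (rule integrable_bounded[where B=1]) (auto simp: indicator_def)
    have "sum q {..<n} = expectation (\<lambda>\<omega>. \<Sum>k<n. indicat_real {y. real k < y} \<bar>\<xi> 1 \<omega>\<bar>)"
      unfolding q_def by (intro Bochner_Integration.integral_sum[symmetric] int)
    also have "\<dots> \<le> expectation (\<lambda>\<omega>. \<bar>\<xi> 1 \<omega>\<bar> + 1)"
      using xi_integrable int
      by (intro integral_mono sum_indicator_less_le) auto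
    finally show "sum q {..<n} \<le> expectation (\<lambda>\<omega>. \<bar>\<xi> 1 \<omega>\<bar> + 1)" .
  qed
  then have "summable (\<lambda>n. prob (A n))"
    by (rule summable_cong[THEN iffD2, rotated])
      (use eventually_ge_at_top[of 1] in eventually_elim, simp add: prob_A)
  then have "AE \<omega> in M. \<forall>\<^sub>F n in sequentially. \<omega> \<in> space M - A n"
    by (intro borel_cantelli_AE1) (auto simp: emeasure_eq_measure)
  then show ?thesis
  proof eventually_elim
    case (elim \<omega>)
    then show ?case by eventually_elim (auto simp: A_def)
  qed
qed

text \<open>Here the zero mean of the innovations enters: the bias caused by truncation disappears
  in the limit by dominated convergence.\<close>

lemma truncated_mean_tendsto_zero:
  "(\<lambda>k. expectation (\<lambda>\<omega>. truncate k (\<xi> 1 \<omega>))) \<longlonglongrightarrow> 0"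
proof -
  have "(\<lambda>k. expectation (\<lambda>\<omega>. truncate k (\<xi> 1 \<omega>))) \<longlonglongrightarrow> expectation (\<xi> 1)"
  proof (rule integral_dominated_convergence[where w="\<lambda>\<omega>. \<bar>\<xi> 1 \<omega>\<bar>"])
    show "AE \<omega> in M. (\<lambda>k. truncate k (\<xi> 1 \<omega>)) \<longlonglongrightarrow> \<xi> 1 \<omega>"
    proof (rule AE_I2)
      fix \<omega>
      show "(\<lambda>k. truncate k (\<xi> 1 \<omega>)) \<longlonglongrightarrow> \<xi> 1 \<omega>"
      proof (rule tendsto_eventually)
        show "\<forall>\<^sub>F k in sequentially. truncate k (\<xi> 1 \<omega>) = \<xi> 1 \<omega>"
          using eventually_ge_at_top[of "nat \<lceil>\<bar>\<xi> 1 \<omega>\<bar>\<rceil>"]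
          by eventually_elim (auto simp: truncate_def)
      qed
    qed
  qed (use xi_integrable abs_truncate_le(2) in auto)
  then show ?thesis using xi_mean_zero by simp
qed

lemma summable_truncated_second_moment:
  "summable (\<lambda>n. expectation (\<lambda>\<omega>. (truncate (Suc n) (\<xi> 1 \<omega>))\<^sup>2) / (real (Suc n))\<^sup>2)"
proof (rule summableI_nonneg_bounded)
  fix n
  define Z where "Z k \<omega> = (truncate k (\<xi> 1 \<omega>))\<^sup>2 / (real k)\<^sup>2" for k \<omega>
  have int: "integrable M (Z k)" for k
  proof (rule integrable_bounded[where B="(real k)\<^sup>2 / (real k)\<^sup>2"])
    show "\<bar>Z k \<omega>\<bar> \<le> (real k)\<^sup>2 / (real k)\<^sup>2" for \<omega>
      using abs_truncate_le(1)[of k "\<xi> 1 \<omega>"]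
      by (auto simp: Z_def intro!: divide_right_mono abs_le_square_iff[THEN iffD1])
    show "Z k \<in> borel_measurable M" unfolding Z_def[abs_def] by measurable
  qed
  have "(\<Sum>i<n. expectation (\<lambda>\<omega>. (truncate (Suc i) (\<xi> 1 \<omega>))\<^sup>2) / (real (Suc i))\<^sup>2) = (\<Sum>k=1..n. expectation (Z k))"
    by (simp add: Z_def[abs_def] sum.atLeast1_atMost_eq del: of_nat_Suc)
  also have "\<dots> = expectation (\<lambda>\<omega>. \<Sum>k=1..n. Z k \<omega>)" using int by simp
  also have "\<dots> \<le> expectation (\<lambda>\<omega>. 2 * \<bar>\<xi> 1 \<omega>\<bar>)"
    using xi_integrable int
  proof (intro integral_mono)
    show "(\<Sum>k=1..n. Z k \<omega>) \<le> 2 * \<bar>\<xi> 1 \<omega>\<bar>" for \<omega>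
      unfolding Z_def by (rule sum_truncate_squares_le)
  qed auto
  finally show "(\<Sum>i<n. expectation (\<lambda>\<omega>. (truncate (Suc i) (\<xi> 1 \<omega>))\<^sup>2) / (real (Suc i))\<^sup>2)
      \<le> expectation (\<lambda>\<omega>. 2 * \<bar>\<xi> 1 \<omega>\<bar>)" .
qed simp

text \<open>The truncated step minus its conditional mean. Index 0 is set to 0 because the first
  step has no memory and \<open>expectation_step\<close> begins at n = 1.\<close>

definition noise :: "nat \<Rightarrow> 'a \<Rightarrow> real" where
  "noise n \<omega> = (if n = 0 then 0
     else truncate (Suc n) (X (Suc n) \<omega>) - compensator (truncate (Suc n)) n \<omega>)"

lemma noise_filtration: "noise n \<in> borel_measurable (filtration (Suc n))"
proof (cases "n = 0")
  case False
  have [measurable]: "X (Suc n) \<in> borel_measurable (filtration (Suc n))" by (rule step_filtration) simp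
  have [measurable]: "compensator (truncate (Suc n)) n \<in> borel_measurable (filtration (Suc n))"
    by (rule measurable_filtration_mono[OF compensator_filtration]) auto
  show ?thesis using False unfolding noise_def[abs_def] by simp
qed (simp add: noise_def[abs_def])

lemma noise_bounded: "\<exists>B. \<forall>\<omega>\<in>space M. \<bar>noise n \<omega>\<bar> \<le> B"
proof -
  obtain B where B: "\<And>\<omega>. \<omega> \<in> space M \<Longrightarrow> \<bar>compensator (truncate (Suc n)) n \<omega>\<bar> \<le> B"
    using compensator_bounded[of "truncate (Suc n)", OF abs_truncate_le(1)] by blast
  have "\<bar>noise n \<omega>\<bar> \<le> real (Suc n) + B" if "\<omega> \<in> space M" for \<omega>
    using B[OF that] abs_truncate_le(1)[of "Suc n" "X (Suc n) \<omega>"] unfolding noise_def by (auto simp del: of_nat_Suc)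
  then show ?thesis by blast
qed

lemma noise_orthogonal:
  assumes G: "G \<in> borel_measurable (filtration n)" and bG: "\<exists>B. \<forall>\<omega>\<in>space M. \<bar>G \<omega>\<bar> \<le> B"
  shows "expectation (\<lambda>\<omega>. G \<omega> * noise n \<omega>) = 0"
proof (cases "n = 0")
  case False
  obtain BG where BG: "\<And>\<omega>. \<omega> \<in> space M \<Longrightarrow> \<bar>G \<omega>\<bar> \<le> BG" using bG by blast
  obtain BC where BC: "\<And>\<omega>. \<omega> \<in> space M \<Longrightarrow> \<bar>compensator (truncate (Suc n)) n \<omega>\<bar> \<le> BC"
    using compensator_bounded[of "truncate (Suc n)", OF abs_truncate_le(1)] by blast
  note [measurable] = measurable_filtration_M[OF G]
    measurable_filtration_M[OF compensator_filtration[OF truncate_measurable]]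
  have mult_bound: "\<bar>G \<omega> * y\<bar> \<le> BG * c" if "\<omega> \<in> space M" "\<bar>y\<bar> \<le> c" for \<omega> y c
    unfolding abs_mult using BG[OF that(1)] that(2) by (intro mult_mono) (auto intro: order_trans[OF abs_ge_zero])
  have "integrable M (\<lambda>\<omega>. G \<omega> * truncate (Suc n) (X (Suc n) \<omega>))"
    by (rule integrable_bounded[OF _ mult_bound[OF _ abs_truncate_le(1)]]) auto
  moreover have "integrable M (\<lambda>\<omega>. G \<omega> * compensator (truncate (Suc n)) n \<omega>)"
    by (rule integrable_bounded[OF _ mult_bound[OF _ BC]]) auto
  ultimately have "expectation (\<lambda>\<omega>. G \<omega> * noise n \<omega>) =
      expectation (\<lambda>\<omega>. G \<omega> * truncate (Suc n) (X (Suc n) \<omega>)) -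
      expectation (\<lambda>\<omega>. G \<omega> * compensator (truncate (Suc n)) n \<omega>)"
    using False by (simp add: noise_def right_diff_distrib)
  also have "\<dots> = 0"
    using expectation_step[OF _ G BG truncate_measurable abs_truncate_le(1)] False by simp
  finally show ?thesis .
qed (simp add: noise_def)

text \<open>Subtracting a conditional mean is an orthogonal projection. In the expansion (Y - C)^2 =
  Y^2 - C^2 - 2 * C * (Y - C) the last term has mean 0 by \<open>noise_orthogonal\<close>, because C
  belongs to the past.\<close>

lemma noise_second_moment:
  "expectation (\<lambda>\<omega>. (noise n \<omega>)\<^sup>2) \<le> expectation (\<lambda>\<omega>. (truncate (Suc n) (\<xi> 1 \<omega>))\<^sup>2)"
proof (cases "n = 0")
  case False
  define C where "C = compensator (truncate (Suc n)) n"
  define Y where "Y \<omega> = truncate (Suc n) (X (Suc n) \<omega>)" for \<omega>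
  have CF: "C \<in> borel_measurable (filtration n)"
    unfolding C_def by (rule compensator_filtration) measurable
  note [measurable] = measurable_filtration_M[OF CF]
  have [measurable]: "Y \<in> borel_measurable M" unfolding Y_def by measurable
  have bC: "\<exists>B. \<forall>\<omega>\<in>space M. \<bar>C \<omega>\<bar> \<le> B"
    unfolding C_def by (rule compensator_bounded[OF abs_truncate_le(1)])
  obtain BC where BC: "\<And>\<omega>. \<omega> \<in> space M \<Longrightarrow> \<bar>C \<omega>\<bar> \<le> BC" using bC by blast
  have BY: "\<bar>Y \<omega>\<bar> \<le> real (Suc n)" for \<omega> unfolding Y_def by (rule abs_truncate_le)
  have N: "noise n \<omega> = Y \<omega> - C \<omega>" for \<omega> using False by (simp add: noise_def Y_def C_def)
  have "integrable M (\<lambda>\<omega>. (Y \<omega>)\<^sup>2)"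
    using BY by (intro integrable_bounded[where B="(real (Suc n))\<^sup>2"]) (auto intro!: abs_le_square_iff[THEN iffD1])
  moreover have "integrable M (\<lambda>\<omega>. (C \<omega>)\<^sup>2)"
    using BC by (intro integrable_bounded[where B="BC\<^sup>2"]) (auto intro!: abs_le_square_iff[THEN iffD1] order_trans[OF BC abs_ge_self])
  moreover have "integrable M (\<lambda>\<omega>. C \<omega> * noise n \<omega>)"
  proof -
    obtain BN where BN: "\<And>\<omega>. \<omega> \<in> space M \<Longrightarrow> \<bar>noise n \<omega>\<bar> \<le> BN" using noise_bounded by blast
    show ?thesis
    proof (rule integrable_bounded[where B="BC * BN"])
      show "\<bar>C \<omega> * noise n \<omega>\<bar> \<le> BC * BN" if "\<omega> \<in> space M" for \<omega>
        unfolding abs_mult using BC[OF that] BN[OF that] by (intro mult_mono) (auto intro: order_trans[OF abs_ge_zero])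
      show "(\<lambda>\<omega>. C \<omega> * noise n \<omega>) \<in> borel_measurable M" unfolding N by measurable
    qed
  qed
  moreover have "(\<lambda>\<omega>. (noise n \<omega>)\<^sup>2) = (\<lambda>\<omega>. (Y \<omega>)\<^sup>2 - (C \<omega>)\<^sup>2 - 2 * (C \<omega> * noise n \<omega>))"
    unfolding N by (simp add: power2_eq_square algebra_simps)
  ultimately have "expectation (\<lambda>\<omega>. (noise n \<omega>)\<^sup>2) = expectation (\<lambda>\<omega>. (Y \<omega>)\<^sup>2) - expectation (\<lambda>\<omega>. (C \<omega>)\<^sup>2)"
    using noise_orthogonal[OF CF bC] by simp
  also have "\<dots> \<le> expectation (\<lambda>\<omega>. (Y \<omega>)\<^sup>2)" by simp
  also have "\<dots> = expectation (\<lambda>\<omega>. (truncate (Suc n) (\<xi> 1 \<omega>))\<^sup>2)"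
    unfolding Y_def by (rule integral_step[where h="\<lambda>x. (truncate (Suc n) x)\<^sup>2"]) auto
  finally show ?thesis .
qed (simp add: noise_def)

text \<open>General weights, because two series are needed: the memory ratios for the weighted
  average W, and 1 / (n + 1) for the walk itself.\<close>

lemma AE_noise_summable:
  assumes b: "\<And>n. \<bar>b n\<bar> \<le> C / real (Suc n)"
  shows "AE \<omega> in M. summable (\<lambda>n. b n * noise n \<omega>)"
proof (rule martingale_differences_summable[where F=filtration and d="\<lambda>n \<omega>. b n * noise n \<omega>"])
  show "sets (filtration n) \<subseteq> sets M" for n by (rule filtration_subset)
  show "sets (filtration n) \<subseteq> sets (filtration (Suc n))" for n by (rule filtration_mono) simp
  show "(\<lambda>\<omega>. b n * noise n \<omega>) \<in> borel_measurable (filtration (Suc n))" for n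
    using noise_filtration[of n] by measurable
  show "\<exists>B. \<forall>\<omega>\<in>space M. \<bar>b n * noise n \<omega>\<bar> \<le> B" for n
  proof -
    obtain B where "\<And>\<omega>. \<omega> \<in> space M \<Longrightarrow> \<bar>noise n \<omega>\<bar> \<le> B" using noise_bounded by blast
    then show ?thesis by (intro exI[of _ "\<bar>b n\<bar> * B"]) (auto simp: abs_mult mult_left_mono)
  qed
  show "expectation (\<lambda>\<omega>. G \<omega> * (b n * noise n \<omega>)) = 0"
    if "G \<in> borel_measurable (filtration n)" "\<exists>B. \<forall>\<omega>\<in>space M. \<bar>G \<omega>\<bar> \<le> B" for n G
  proof -
    have "(\<lambda>\<omega>. G \<omega> * (b n * noise n \<omega>)) = (\<lambda>\<omega>. b n * (G \<omega> * noise n \<omega>))"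
      by (simp add: mult_ac)
    then show ?thesis using noise_orthogonal[OF that] by simp
  qed
  show "summable (\<lambda>n. expectation (\<lambda>\<omega>. (b n * noise n \<omega>)\<^sup>2))"
  proof (rule summable_comparison_test'[OF summable_mult[OF summable_truncated_second_moment, of "C\<^sup>2"]])
    fix n
    have "(b n)\<^sup>2 \<le> (C / real (Suc n))\<^sup>2"
      using b[of n] by (intro abs_le_square_iff[THEN iffD1]) linarith
    then have "(b n)\<^sup>2 * expectation (\<lambda>\<omega>. (noise n \<omega>)\<^sup>2)
        \<le> (C / real (Suc n))\<^sup>2 * expectation (\<lambda>\<omega>. (truncate (Suc n) (\<xi> 1 \<omega>))\<^sup>2)"
      using noise_second_moment by (intro mult_mono) auto
    then show "norm (expectation (\<lambda>\<omega>. (b n * noise n \<omega>)\<^sup>2))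
        \<le> C\<^sup>2 * (expectation (\<lambda>\<omega>. (truncate (Suc n) (\<xi> 1 \<omega>))\<^sup>2) / (real (Suc n))\<^sup>2)"
      by (simp add: power_mult_distrib power_divide)
  qed
qed simp

lemma noise_eventually:
  assumes ev: "\<forall>\<^sub>F n in sequentially. \<bar>X n \<omega>\<bar> \<le> real n"
  shows "\<forall>\<^sub>F n in sequentially. noise n \<omega> = X (Suc n) \<omega>
    - p * ((\<Sum>j=1..n. \<mu> j * X j \<omega>) / memory_sum \<mu> n) - (1 - p) * expectation (\<lambda>\<omega>. truncate (Suc n) (\<xi> 1 \<omega>))"
proof -
  obtain K where K: "\<And>k. k \<ge> K \<Longrightarrow> \<bar>X k \<omega>\<bar> \<le> real k"
    using ev by (auto simp: eventually_sequentially)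
  \<comment> \<open>From L on the level dominates each of the finitely many values before K, being
    at least the sum of their moduli. A step with K <= j <= n + 1 is bounded by its own index, hence
    by the level.\<close>
  define L where "L = max (Suc K) (nat \<lceil>\<Sum>k<K. \<bar>X k \<omega>\<bar>\<rceil>)"
  show ?thesis using eventually_ge_at_top[of L]
  proof eventually_elim
    case (elim n)
    have n: "n \<ge> 1" "n \<ge> K" "(\<Sum>k<K. \<bar>X k \<omega>\<bar>) \<le> real n"
      using elim unfolding L_def by linarith+
    have small: "truncate (Suc n) (X j \<omega>) = X j \<omega>" if "j \<le> Suc n" for j
    proof (cases "j < K")
      case True
      then have "\<bar>X j \<omega>\<bar> \<le> (\<Sum>k<K. \<bar>X k \<omega>\<bar>)" by (intro member_le_sum) auto
      then show ?thesis using n by (simp add: truncate_def)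
    next
      case False
      then show ?thesis using K[of j] that by (simp add: truncate_def)
    qed
    have "(\<Sum>j=1..n. \<mu> j / memory_sum \<mu> n * truncate (Suc n) (X j \<omega>)) = (\<Sum>j=1..n. \<mu> j * X j \<omega>) / memory_sum \<mu> n"
      unfolding sum_divide_distrib by (intro sum.cong) (auto simp: small)
    then show ?case using n small[of "Suc n"] by (simp add: noise_def compensator_def)
  qed
qed

lemma AE_srrw_tendsto_zero:
  assumes p1: "p < 1"
  shows "AE \<omega> in M. (\<lambda>n. srrw \<xi> \<alpha> \<beta> n \<omega> / real n) \<longlonglongrightarrow> 0"
proof -
  define a where "a n = \<mu> (Suc n) / memory_sum \<mu> (Suc n)" for n
  define e where "e n = (1 - p) * expectation (\<lambda>\<omega>. truncate (Suc n) (\<xi> 1 \<omega>))" for n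
  obtain C where C: "\<And>n. n \<ge> 1 \<Longrightarrow> \<mu> n / memory_sum \<mu> n \<le> C / real n"
    using regularly_varying_ratio_bound[OF mu_regularly_varying] by blast
  have aC: "a n \<le> C / real (Suc n)" for n unfolding a_def by (rule C) simp
  have a0: "0 \<le> a n" for n
    unfolding a_def using mu_pos[of "Suc n"] nu_pos[of "Suc n"] by simp
  have C0: "(\<lambda>n. C / real (Suc n)) \<longlonglongrightarrow> 0" for C by (rule LIMSEQ_Suc[OF lim_const_over_n])
  have a_lim: "a \<longlonglongrightarrow> 0"
    by (rule tendsto_sandwich[OF _ _ tendsto_const C0[of C]]) (use a0 aC in auto)
  have a_nsum: "\<not> summable a"
    unfolding a_def using memory_sum_at_top[OF mu_regularly_varying gamma_gt]
    by (intro not_summable_memory_ratio mu_pos)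
  have e_lim: "e \<longlonglongrightarrow> 0"
    unfolding e_def using LIMSEQ_Suc[OF truncated_mean_tendsto_zero] by (rule tendsto_mult_right_zero)
  have "AE \<omega> in M. summable (\<lambda>n. a n * noise n \<omega>)"
    using aC a0 by (intro AE_noise_summable[where C=C]) simp
  moreover have "AE \<omega> in M. summable (\<lambda>n. 1 / real (Suc n) * noise n \<omega>)"
    by (intro AE_noise_summable[where C=1]) simp
  ultimately show ?thesis using AE_step_le_index
  proof eventually_elim
    case (elim \<omega>)
    define W where "W n = (\<Sum>j=1..n. \<mu> j * X j \<omega>) / memory_sum \<mu> n" for n
    have noise: "\<forall>\<^sub>F n in sequentially. noise n \<omega> = X (Suc n) \<omega> - p * W n - e n"
      using noise_eventually[OF elim(3)] by (simp add: W_def e_def)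
    have W_lim: "W \<longlonglongrightarrow> 0"
    proof (rule stochastic_approximation_tendsto_zero[OF _ a0 a_lim a_nsum elim(1) e_lim])
      show "0 < 1 - p" using p1 by simp
      show "\<forall>\<^sub>F n in sequentially. W (Suc n) = (1 - (1 - p) * a n) * W n + a n * (e n + noise n \<omega>)"
        using noise eventually_ge_at_top[of 1]
      proof eventually_elim
        case (elim n)
        let ?v = "memory_sum \<mu> n" and ?v' = "memory_sum \<mu> (Suc n)"
        have v: "?v > 0" "?v' > 0" using elim nu_pos by auto
        have v': "?v' = ?v + \<mu> (Suc n)" by (rule memory_sum_Suc)
        have "W (Suc n) = (?v * W n + \<mu> (Suc n) * X (Suc n) \<omega>) / ?v'"
          using v by (simp add: W_def)
        also have "\<dots> = (1 - a n) * W n + a n * X (Suc n) \<omega>"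
        proof -
          have "?v = ?v' - \<mu> (Suc n)" using v' by simp
          then have "1 - a n = ?v / ?v'" using v by (simp add: a_def diff_divide_distrib)
          then show ?thesis by (simp add: a_def add_divide_distrib)
        qed
        also have "X (Suc n) \<omega> = noise n \<omega> + p * W n + e n" using elim by simp
        finally show ?case by (simp add: algebra_simps)
      qed
    qed
    \<comment> \<open>The rate is now c = 1 and not 1 - p: the drift \<open>p * W n\<close> is no
      multiple of the current state but a sequence already known to vanish.\<close>
    show "(\<lambda>n. srrw \<xi> \<alpha> \<beta> n \<omega> / real n) \<longlonglongrightarrow> 0"
    proof (rule stochastic_approximation_tendsto_zero[where c=1 and a="\<lambda>n. 1 / real (Suc n)" and d="\<lambda>n. noise n \<omega>" and \<delta>="\<lambda>n. p * W n + e n"])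
      show "(\<lambda>n. 1 / real (Suc n)) \<longlonglongrightarrow> 0" by (rule C0)
      show "\<not> summable (\<lambda>n. 1 / real (Suc n))"
        using not_summable_harmonic[where 'a=real] summable_Suc_iff[of "\<lambda>n. 1 / real n"]
        by (simp add: inverse_eq_divide del: of_nat_Suc)
      show "summable (\<lambda>n. 1 / real (Suc n) * noise n \<omega>)" by (rule elim(2))
      show "(\<lambda>n. p * W n + e n) \<longlonglongrightarrow> 0"
        using tendsto_add[OF tendsto_mult_right_zero[OF W_lim] e_lim] by simp
      show "\<forall>\<^sub>F n in sequentially. srrw \<xi> \<alpha> \<beta> (Suc n) \<omega> / real (Suc n) =
          (1 - 1 * (1 / real (Suc n))) * (srrw \<xi> \<alpha> \<beta> n \<omega> / real n)
          + 1 / real (Suc n) * (p * W n + e n + noise n \<omega>)"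
        using noise eventually_ge_at_top[of 1]
      proof eventually_elim
        case (elim n)
        have "p * W n + e n + noise n \<omega> = X (Suc n) \<omega>" using elim by simp
        moreover have "srrw \<xi> \<alpha> \<beta> (Suc n) \<omega> = srrw \<xi> \<alpha> \<beta> n \<omega> + X (Suc n) \<omega>"
          by (simp add: srrw_def)
        moreover have "1 - 1 * (1 / real (Suc n)) = real n / real (Suc n)" by (simp add: field_simps)
        ultimately show ?case using elim by (simp add: add_divide_distrib)
      qed
    qed auto
  qed
qed

end

section \<open>Convergence in mean and path space\<close>

lemma rcll_step_function:
  fixes g :: "nat \<Rightarrow> real"
  shows "rcll (\<lambda>t. g (nat \<lfloor>real n * t\<rfloor>))"
proof (cases "n = 0")
  case False
  then have n: "real n > 0" by simp
  show ?thesis unfolding rcll_def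
  proof (intro conjI allI impI)
    fix t :: real assume "0 \<le> t"
    have "t < (of_int \<lfloor>real n * t\<rfloor> + 1) / real n"
      using n by (simp add: pos_less_divide_eq mult.commute[of _ "real n"])
    moreover have "g (nat \<lfloor>real n * s\<rfloor>) = g (nat \<lfloor>real n * t\<rfloor>)"
      if "t < s" "s < (of_int \<lfloor>real n * t\<rfloor> + 1) / real n" for s
    proof -
      have "real n * t < real n * s" "real n * s < of_int \<lfloor>real n * t\<rfloor> + 1"
        using that n by (simp_all add: pos_less_divide_eq mult.commute[of _ "real n"])
      then have "\<lfloor>real n * s\<rfloor> = \<lfloor>real n * t\<rfloor>" by linarith
      then show ?thesis by simp
    qed
    ultimately have "\<forall>\<^sub>F s in at_right t. g (nat \<lfloor>real n * s\<rfloor>) = g (nat \<lfloor>real n * t\<rfloor>)"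
      unfolding eventually_at_right_field
      by (intro exI[of _ "(of_int \<lfloor>real n * t\<rfloor> + 1) / real n"] conjI allI impI)
    then show "((\<lambda>s. g (nat \<lfloor>real n * s\<rfloor>)) \<longlongrightarrow> g (nat \<lfloor>real n * t\<rfloor>)) (at_right t)"
      by (rule tendsto_eventually)
  next
    fix t :: real assume "0 < t"
    have "(of_int \<lceil>real n * t\<rceil> - 1) / real n < t"
      using n by (simp add: pos_divide_less_eq mult.commute[of t]) linarith
    \<comment> \<open>At a jump time n * t is an integer and the path just before has the preceding
      index. Ceiling minus 1 is the right index there and also between jumps.\<close>
    moreover have "g (nat \<lfloor>real n * s\<rfloor>) = g (nat (\<lceil>real n * t\<rceil> - 1))"
      if "s < t" "(of_int \<lceil>real n * t\<rceil> - 1) / real n < s" for s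
    proof -
      have "real n * s < real n * t" "of_int \<lceil>real n * t\<rceil> - 1 < real n * s"
        using that n by (simp_all add: pos_divide_less_eq mult.commute[of _ "real n"])
      then have "\<lfloor>real n * s\<rfloor> = \<lceil>real n * t\<rceil> - 1" by linarith
      then show ?thesis by simp
    qed
    ultimately have "\<forall>\<^sub>F s in at_left t. g (nat \<lfloor>real n * s\<rfloor>) = g (nat (\<lceil>real n * t\<rceil> - 1))"
      unfolding eventually_at_left_field
      by (intro exI[of _ "(of_int \<lceil>real n * t\<rceil> - 1) / real n"] conjI allI impI)
    then show "\<exists>l. ((\<lambda>s. g (nat \<lfloor>real n * s\<rfloor>)) \<longlongrightarrow> l) (at_left t)"
      by (intro exI tendsto_eventually)
  qed
qed (auto simp: rcll_def)

definition running_max :: "(nat \<Rightarrow> real) \<Rightarrow> nat \<Rightarrow> real" where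
  "running_max s N = Max ((\<lambda>m. \<bar>s m\<bar>) ` {..N})"

lemma running_max_ge: "m \<le> N \<Longrightarrow> \<bar>s m\<bar> \<le> running_max s N"
  unfolding running_max_def by (intro Max_ge) auto

lemma running_max_nonneg: "0 \<le> running_max s N"
  by (rule order_trans[OF abs_ge_zero running_max_ge[of 0]]) simp

lemma running_max_le: "(\<And>m. m \<le> N \<Longrightarrow> \<bar>s m\<bar> \<le> B) \<Longrightarrow> running_max s N \<le> B"
  unfolding running_max_def by (subst Max_le_iff) auto

text \<open>Indices up to N contribute at most the constant B, negligible after division by n. A
  later index m contributes at most e * m <= e * (n * T), so e is chosen with e * T = r / 2.\<close>

lemma running_max_tendsto_zero:
  assumes lim: "(\<lambda>n. s n / real n) \<longlonglongrightarrow> 0" and T: "T > 0"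
  shows "(\<lambda>n. running_max s (nat \<lfloor>real n * T\<rfloor>) / real n) \<longlonglongrightarrow> 0"
proof (rule LIMSEQ_I)
  fix r :: real assume r: "r > 0"
  define e where "e = r / (2 * T)"
  have e: "e > 0" "e * T = r / 2" using r T by (simp_all add: e_def)
  from LIMSEQ_D[OF lim e(1)] obtain N where N: "\<And>n. n \<ge> N \<Longrightarrow> \<bar>s n / real n\<bar> < e" by auto
  define B where "B = (\<Sum>m\<le>N. \<bar>s m\<bar>)"
  have B: "B \<ge> 0" by (simp add: B_def sum_nonneg)
  have "(\<lambda>n. B / real n) \<longlonglongrightarrow> 0" by (rule lim_const_over_n)
  from order_tendstoD(2)[OF this, of "r / 2"] r
  obtain N' where N': "\<And>n. n \<ge> N' \<Longrightarrow> B / real n < r / 2"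
    by (auto simp: eventually_sequentially)
  have "norm (running_max s (nat \<lfloor>real n * T\<rfloor>) / real n - 0) < r" if n: "n \<ge> max 1 N'" for n
  proof -
    have "running_max s (nat \<lfloor>real n * T\<rfloor>) \<le> B + e * (real n * T)"
    proof (rule running_max_le)
      fix m assume "m \<le> nat \<lfloor>real n * T\<rfloor>"
      then have m: "real m \<le> real n * T" using T by (simp add: le_nat_floor le_nat_iff le_floor_iff)
      show "\<bar>s m\<bar> \<le> B + e * (real n * T)"
      proof (cases "m \<le> N")
        case True
        then have "\<bar>s m\<bar> \<le> B" unfolding B_def by (intro member_le_sum) auto
        moreover have "0 \<le> e * (real n * T)" using e T by simp
        ultimately show ?thesis by linarith
      next
        case False
        then have "\<bar>s m\<bar> \<le> e * real m" using N[of m] by (simp add: field_simps)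
        also have "\<dots> \<le> e * (real n * T)" using m e by (intro mult_left_mono) auto
        finally show ?thesis using B by linarith
      qed
    qed
    also have "e * (real n * T) = real n * (r / 2)" by (simp only: mult.left_commute[of e] e(2))
    finally have "running_max s (nat \<lfloor>real n * T\<rfloor>) / real n \<le> (B + real n * (r / 2)) / real n"
      by (intro divide_right_mono) simp_all
    also have "\<dots> = B / real n + r / 2" using n by (simp add: add_divide_distrib)
    also have "\<dots> < r"
    proof -
      have "B / real n < r / 2" using n by (intro N') simp
      then show ?thesis by linarith
    qed
    finally show ?thesis using running_max_nonneg[of s "nat \<lfloor>real n * T\<rfloor>"] by simp
  qed
  then show "\<exists>no. \<forall>n\<ge>no. norm (running_max s (nat \<lfloor>real n * T\<rfloor>) / real n - 0) < r" by blast
qed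

context srrw_rvm
begin

lemma srrw_measurable [measurable]: "srrw \<xi> \<alpha> \<beta> n \<in> borel_measurable M"
  unfolding srrw_def[abs_def] by measurable

text \<open>The averages of the identically distributed \<open>H (X k)\<close> are uniformly integrable, so that a
  sequence dominated by them converges in \<open>L\<^sup>1\<close> as soon as it converges almost surely.\<close>

lemma expectation_tendsto_zero_if_dominated:
  fixes V :: "nat \<Rightarrow> 'a \<Rightarrow> real" and H :: "real \<Rightarrow> real"
  assumes Vm: "\<And>n. V n \<in> borel_measurable M" and V0: "\<And>n \<omega>. 0 \<le> V n \<omega>"
    and V: "\<And>n \<omega>. V n \<omega> \<le> K / real n * (\<Sum>k=1..N n. H (X k \<omega>))"
    and N: "\<And>n. real (N n) \<le> real n * T" and K: "K \<ge> 0" and T: "T \<ge> 0"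
    and H: "H \<in> borel_measurable borel" "\<And>x. 0 \<le> H x" and int: "integrable M (\<lambda>\<omega>. H (\<xi> 1 \<omega>))"
    and lim: "AE \<omega> in M. (\<lambda>n. V n \<omega>) \<longlonglongrightarrow> 0"
  shows "integrable M (V n)" "(\<lambda>n. expectation (V n)) \<longlonglongrightarrow> 0"
proof -
  note [measurable] = Vm H(1)
  have intX: "integrable M (\<lambda>\<omega>. H (X k \<omega>))" if "k \<ge> 1" for k
    using integrable_step_iff[OF H(1) that] int by simp
  have intV: "integrable M (V n)" for n
  proof (rule Bochner_Integration.integrable_bound)
    show "integrable M (\<lambda>\<omega>. K / real n * (\<Sum>k=1..N n. H (X k \<omega>)))"
      by (intro Bochner_Integration.integrable_mult_right Bochner_Integration.integrable_sum intX) auto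
    show "AE \<omega> in M. norm (V n \<omega>) \<le> norm (K / real n * (\<Sum>k=1..N n. H (X k \<omega>)))"
    proof (rule AE_I2)
      fix \<omega>
      show "norm (V n \<omega>) \<le> norm (K / real n * (\<Sum>k=1..N n. H (X k \<omega>)))"
        unfolding real_norm_def abs_of_nonneg[OF V0] by (rule order_trans[OF V abs_ge_self])
    qed
  qed measurable
  then show "integrable M (V n)" .
  \<comment> \<open>The excess over level c. The part of the average below c is at most K * T * c,
    while the mean of the excess part is bounded by K * T * E R(\<open>\<xi> 1\<close>), uniformly
    in n.\<close>
  define R where "R c x = max 0 (H x - real c)" for c :: nat and x
  have Rm [measurable]: "R c \<in> borel_measurable borel" for c unfolding R_def[abs_def] by measurable
  have R: "0 \<le> R c x" "R c x \<le> H x" "H x \<le> real c + R c x" for c x using H(2)[of x] by (auto simp: R_def)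
  have intR: "integrable M (\<lambda>\<omega>. R c (\<xi> 1 \<omega>))" for c
    using int R H(2) by (intro Bochner_Integration.integrable_bound[OF int]) auto
  have R_lim: "(\<lambda>c. expectation (\<lambda>\<omega>. R c (\<xi> 1 \<omega>))) \<longlonglongrightarrow> 0"
  proof -
    have "(\<lambda>c. expectation (\<lambda>\<omega>. R c (\<xi> 1 \<omega>))) \<longlonglongrightarrow> expectation (\<lambda>\<omega>. 0)"
    proof (rule integral_dominated_convergence[where w="\<lambda>\<omega>. H (\<xi> 1 \<omega>)"])
      show "AE \<omega> in M. (\<lambda>c. R c (\<xi> 1 \<omega>)) \<longlonglongrightarrow> 0"
      proof (intro AE_I2 tendsto_eventually)
        fix \<omega>
        show "\<forall>\<^sub>F c in sequentially. R c (\<xi> 1 \<omega>) = 0"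
          using eventually_ge_at_top[of "nat \<lceil>H (\<xi> 1 \<omega>)\<rceil>"] by eventually_elim (auto simp: R_def)
      qed
    qed (use int R in auto)
    then show ?thesis by simp
  qed
  show "(\<lambda>n. expectation (V n)) \<longlonglongrightarrow> 0"
  proof (rule LIMSEQ_I)
    fix r :: real assume r: "r > 0"
    have "(\<lambda>c. K * T * expectation (\<lambda>\<omega>. R c (\<xi> 1 \<omega>))) \<longlonglongrightarrow> 0"
      by (rule tendsto_mult_right_zero[OF R_lim])
    from order_tendstoD(2)[OF this, of "r / 2"] r
    obtain c where c: "K * T * expectation (\<lambda>\<omega>. R c (\<xi> 1 \<omega>)) < r / 2"
      by (auto simp: eventually_sequentially)
    define B where "B = K * T * real c"
    have B: "B \<ge> 0" using K T by (simp add: B_def)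
    have "(\<lambda>n. expectation (\<lambda>\<omega>. min (V n \<omega>) B)) \<longlonglongrightarrow> expectation (\<lambda>\<omega>. 0)"
    proof (rule integral_dominated_convergence[where w="\<lambda>_. B"])
      show "AE \<omega> in M. (\<lambda>n. min (V n \<omega>) B) \<longlonglongrightarrow> 0"
        using lim
      proof eventually_elim
        case (elim \<omega>)
        show ?case using tendsto_min[OF elim tendsto_const[of B]] B by simp
      qed
      show "AE \<omega> in M. norm (min (V n \<omega>) B) \<le> B" for n
        using V0 B by (intro AE_I2) auto
    qed auto
    from LIMSEQ_D[OF this, of "r / 2"] r
    obtain n0 where n0: "\<And>n. n \<ge> n0 \<Longrightarrow> \<bar>expectation (\<lambda>\<omega>. min (V n \<omega>) B)\<bar> < r / 2" by auto
    have "norm (expectation (V n) - 0) < r" if n: "n \<ge> max 1 n0" for n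
    proof -
      define U where "U \<omega> = K / real n * (\<Sum>k=1..N n. R c (X k \<omega>))" for \<omega>
      have Kn: "K / real n * real (N n) \<le> K * T"
      proof -
        have "K / real n * real (N n) \<le> K / real n * (real n * T)"
          using N[of n] K by (intro mult_left_mono) auto
        then show ?thesis using n by simp
      qed
      have intRX: "integrable M (\<lambda>\<omega>. R c (X k \<omega>))" if "k \<ge> 1" for k
        using integrable_step_iff[OF Rm that] intR by simp
      have intU: "integrable M U"
        unfolding U_def[abs_def]
        by (intro Bochner_Integration.integrable_mult_right Bochner_Integration.integrable_sum intRX) auto
      have U0: "0 \<le> U \<omega>" for \<omega>
        unfolding U_def using K R by (intro mult_nonneg_nonneg divide_nonneg_nonneg sum_nonneg) auto
      \<comment> \<open>Splitting V at B leaves a bounded part, whose mean tends to 0 by dominated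
        convergence, and a remainder U with small mean for every n >= 1.\<close>
      have le: "V n \<omega> \<le> min (V n \<omega>) B + U \<omega>" for \<omega>
      proof -
        have "V n \<omega> \<le> K / real n * (\<Sum>k=1..N n. H (X k \<omega>))" by (rule V)
        also have "\<dots> \<le> K / real n * (\<Sum>k=1..N n. real c + R c (X k \<omega>))"
          using K R by (intro mult_left_mono sum_mono) auto
        also have "\<dots> = K / real n * real (N n) * real c + U \<omega>"
          by (simp add: sum.distrib U_def distrib_left)
        also have "\<dots> \<le> B + U \<omega>"
          unfolding B_def using Kn by (intro add_right_mono mult_right_mono) auto
        finally show ?thesis using U0[of \<omega>] by (auto simp: min_def)
      qed
      have intm: "integrable M (\<lambda>\<omega>. min (V n \<omega>) B)"
        using V0 B by (intro integrable_bounded[where B=B]) auto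
      have "expectation (V n) \<le> expectation (\<lambda>\<omega>. min (V n \<omega>) B + U \<omega>)"
        using intV intm intU le by (intro integral_mono) auto
      also have "\<dots> = expectation (\<lambda>\<omega>. min (V n \<omega>) B) + expectation U"
        using intm intU by simp
      also have "expectation U = K / real n * (\<Sum>k=1..N n. expectation (\<lambda>\<omega>. R c (X k \<omega>)))"
        unfolding U_def[abs_def] using intRX by simp
      also have "(\<Sum>k=1..N n. expectation (\<lambda>\<omega>. R c (X k \<omega>))) = real (N n) * expectation (\<lambda>\<omega>. R c (\<xi> 1 \<omega>))"
        using integral_step[OF Rm] by simp
      also have "K / real n * (real (N n) * expectation (\<lambda>\<omega>. R c (\<xi> 1 \<omega>)))
          \<le> K * T * expectation (\<lambda>\<omega>. R c (\<xi> 1 \<omega>))"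
        unfolding mult.assoc[symmetric] using Kn R by (intro mult_right_mono) auto
      finally have "expectation (V n) < r" using c n0[of n] n by linarith
      moreover have "0 \<le> expectation (V n)" using V0 by simp
      ultimately show ?thesis by simp
    qed
    then show "\<exists>no. \<forall>n\<ge>no. norm (expectation (V n) - 0) < r" by blast
  qed
qed

text \<open>A measurable majorant of \<open>sup_dist\<close>: a maximum over finitely many indices
  replaces the supremum over [0, T]. Monotonicity of the nonnegative integral then suffices for the
  convergence in mean.\<close>

definition scaled_max :: "real \<Rightarrow> nat \<Rightarrow> 'a \<Rightarrow> real" where
  "scaled_max T n \<omega> = running_max (\<lambda>m. srrw \<xi> \<alpha> \<beta> m \<omega>) (nat \<lfloor>real n * T\<rfloor>) / real n"

lemma scaled_max_measurable [measurable]: "scaled_max T n \<in> borel_measurable M"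
  unfolding scaled_max_def[abs_def] running_max_def by measurable

lemma scaled_max_nonneg: "0 \<le> scaled_max T n \<omega>"
  by (simp add: scaled_max_def running_max_nonneg)

lemma sup_dist_le_scaled_max:
  "sup_dist T (scaled_srrw \<xi> \<alpha> \<beta> n) (\<lambda>_ _. 0) \<omega> \<le> ennreal (scaled_max T n \<omega>)"
  unfolding sup_dist_def
proof (rule SUP_least)
  fix t assume "t \<in> {0..T}"
  then have "nat \<lfloor>real n * t\<rfloor> \<le> nat \<lfloor>real n * T\<rfloor>"
    by (intro nat_mono floor_mono mult_left_mono) auto
  from running_max_ge[OF this, of "\<lambda>m. srrw \<xi> \<alpha> \<beta> m \<omega>"]
  show "ennreal \<bar>scaled_srrw \<xi> \<alpha> \<beta> n t \<omega> - 0\<bar> \<le> ennreal (scaled_max T n \<omega>)"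
    by (intro ennreal_leI) (simp add: scaled_srrw_def scaled_max_def divide_right_mono)
qed

lemma AE_scaled_max_tendsto_zero:
  assumes "p < 1" "T > 0"
  shows "AE \<omega> in M. (\<lambda>n. scaled_max T n \<omega>) \<longlonglongrightarrow> 0"
  using AE_srrw_tendsto_zero[OF assms(1)]
proof eventually_elim
  case (elim \<omega>)
  show ?case unfolding scaled_max_def by (rule running_max_tendsto_zero[OF elim assms(2)])
qed

lemma scaled_max_le_average:
  "scaled_max T n \<omega> \<le> (\<Sum>k=1..nat \<lfloor>real n * T\<rfloor>. \<bar>X k \<omega>\<bar>) / real n"
  unfolding scaled_max_def
proof (intro divide_right_mono running_max_le)
  fix m assume "m \<le> nat \<lfloor>real n * T\<rfloor>"
  then have "(\<Sum>k=1..m. \<bar>X k \<omega>\<bar>) \<le> (\<Sum>k=1..nat \<lfloor>real n * T\<rfloor>. \<bar>X k \<omega>\<bar>)"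
    by (intro sum_mono2) auto
  then show "\<bar>srrw \<xi> \<alpha> \<beta> m \<omega>\<bar> \<le> (\<Sum>k=1..nat \<lfloor>real n * T\<rfloor>. \<bar>X k \<omega>\<bar>)"
    unfolding srrw_def using sum_abs[of "\<lambda>k. X k \<omega>" "{1..m}"] by linarith
qed simp

text \<open>By Cauchy-Schwarz the squared sum is at most the number of terms times the sum of
  squares; that number is at most n * T, which is where the factor T comes from.\<close>

lemma scaled_max_power2_le_average:
  assumes "T \<ge> 0"
  shows "(scaled_max T n \<omega>)\<^sup>2 \<le> T / real n * (\<Sum>k=1..nat \<lfloor>real n * T\<rfloor>. (X k \<omega>)\<^sup>2)"
proof (cases "n = 0")
  case False
  let ?N = "nat \<lfloor>real n * T\<rfloor>"
  have N: "real ?N \<le> real n * T" using assms by simp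
  have "(scaled_max T n \<omega>)\<^sup>2 \<le> ((\<Sum>k=1..?N. \<bar>X k \<omega>\<bar>) / real n)\<^sup>2"
    by (intro power_mono scaled_max_le_average scaled_max_nonneg)
  also have "\<dots> = (\<Sum>k=1..?N. \<bar>X k \<omega>\<bar> * 1)\<^sup>2 / (real n)\<^sup>2" by (simp add: power_divide)
  also have "\<dots> \<le> ((\<Sum>k=1..?N. \<bar>X k \<omega>\<bar>\<^sup>2) * (\<Sum>k=1..?N. 1\<^sup>2)) / (real n)\<^sup>2"
    by (intro divide_right_mono Cauchy_Schwarz_ineq_sum) simp
  also have "\<dots> \<le> ((\<Sum>k=1..?N. (X k \<omega>)\<^sup>2) * (real n * T)) / (real n)\<^sup>2"
    using N by (intro divide_right_mono mult_mono) (auto intro: sum_nonneg)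
  also have "\<dots> = T / real n * (\<Sum>k=1..?N. (X k \<omega>)\<^sup>2)"
    using False by (simp add: power2_eq_square)
  finally show ?thesis .
qed (simp add: scaled_max_def)

section \<open>Convergence in path space\<close>

lemma random_element_scaled_srrw: "random_element_D M (scaled_srrw \<xi> \<alpha> \<beta> n)"
proof -
  have "rcll (\<lambda>t. scaled_srrw \<xi> \<alpha> \<beta> n t \<omega>)" for \<omega>
    unfolding scaled_srrw_def by (rule rcll_step_function)
  then show ?thesis unfolding random_element_D_def scaled_srrw_def[abs_def] by simp
qed

lemma random_element_zero: "random_element_D M (\<lambda>_ _. 0)"
  by (auto simp: random_element_D_def rcll_def)

lemma converges_as_scaled_srrw:
  assumes "p < 1"
  shows "converges_as_in_D M (scaled_srrw \<xi> \<alpha> \<beta>) (\<lambda>_ _. 0)"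
  unfolding converges_as_in_D_def
proof (intro conjI allI impI ballI random_element_scaled_srrw random_element_zero)
  fix T :: real assume "T > 0"
  from AE_scaled_max_tendsto_zero[OF assms this]
  show "AE \<omega> in M. (\<lambda>n. sup_dist T (scaled_srrw \<xi> \<alpha> \<beta> n) (\<lambda>_ _. 0) \<omega>) \<longlonglongrightarrow> 0"
  proof eventually_elim
    case (elim \<omega>)
    show ?case
    proof (rule tendsto_sandwich[OF _ _ tendsto_const])
      show "(\<lambda>n. ennreal (scaled_max T n \<omega>)) \<longlonglongrightarrow> 0"
        using tendsto_ennrealI[OF elim] by simp
    qed (simp_all add: sup_dist_le_scaled_max)
  qed
qed simp

lemma converges_Lr_scaled_srrw:
  assumes int: "\<And>T n. T > 0 \<Longrightarrow> integrable M (\<lambda>\<omega>. (scaled_max T n \<omega>) ^ r)"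
    and lim: "\<And>T. T > 0 \<Longrightarrow> (\<lambda>n. expectation (\<lambda>\<omega>. (scaled_max T n \<omega>) ^ r)) \<longlonglongrightarrow> 0"
  shows "converges_Lr_in_D r M (scaled_srrw \<xi> \<alpha> \<beta>) (\<lambda>_ _. 0)"
proof -
  have le: "(\<integral>\<^sup>+ \<omega>. sup_dist T (scaled_srrw \<xi> \<alpha> \<beta> n) (\<lambda>_ _. 0) \<omega> ^ r \<partial>M)
      \<le> ennreal (expectation (\<lambda>\<omega>. (scaled_max T n \<omega>) ^ r))" if T: "T > 0" for T n
  proof -
    have "(\<integral>\<^sup>+ \<omega>. sup_dist T (scaled_srrw \<xi> \<alpha> \<beta> n) (\<lambda>_ _. 0) \<omega> ^ r \<partial>M)
        \<le> (\<integral>\<^sup>+ \<omega>. ennreal ((scaled_max T n \<omega>) ^ r) \<partial>M)"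
      by (intro nn_integral_mono)
        (simp add: ennreal_power[symmetric] scaled_max_nonneg power_mono sup_dist_le_scaled_max)
    also have "\<dots> = ennreal (expectation (\<lambda>\<omega>. (scaled_max T n \<omega>) ^ r))"
      by (intro nn_integral_eq_integral int T) (simp add: scaled_max_nonneg)
    finally show ?thesis .
  qed
  show ?thesis unfolding converges_Lr_in_D_def
  proof (intro conjI allI impI ballI random_element_scaled_srrw random_element_zero)
    fix T :: real assume T: "T > 0"
    show "(\<integral>\<^sup>+ \<omega>. sup_dist T (scaled_srrw \<xi> \<alpha> \<beta> n) (\<lambda>_ _. 0) \<omega> ^ r \<partial>M) < \<infinity>" for n
      using le_less_trans[OF le[OF T]] by simp
    show "(\<lambda>n. \<integral>\<^sup>+ \<omega>. sup_dist T (scaled_srrw \<xi> \<alpha> \<beta> n) (\<lambda>_ _. 0) \<omega> ^ r \<partial>M) \<longlonglongrightarrow> 0"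
    proof (rule tendsto_sandwich[OF _ _ tendsto_const])
      show "(\<lambda>n. ennreal (expectation (\<lambda>\<omega>. (scaled_max T n \<omega>) ^ r))) \<longlonglongrightarrow> 0"
        using tendsto_ennrealI[OF lim[OF T]] by simp
    qed (simp_all add: le[OF T])
  qed simp
qed

lemma converges_L1_scaled_srrw:
  assumes p1: "p < 1"
  shows "converges_Lr_in_D 1 M (scaled_srrw \<xi> \<alpha> \<beta>) (\<lambda>_ _. 0)"
proof (rule converges_Lr_scaled_srrw)
  fix T :: real assume T: "T > 0"
  have V: "scaled_max T n \<omega> \<le> 1 / real n * (\<Sum>k=1..nat \<lfloor>real n * T\<rfloor>. \<bar>X k \<omega>\<bar>)" for n \<omega>
    using scaled_max_le_average by simp
  have N: "real (nat \<lfloor>real n * T\<rfloor>) \<le> real n * T" for n using T by simp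
  note dominated = expectation_tendsto_zero_if_dominated[where V="scaled_max T" and H=abs and K=1 and T=T
      and N="\<lambda>n. nat \<lfloor>real n * T\<rfloor>", OF scaled_max_measurable scaled_max_nonneg V N _ _ _ abs_ge_zero
      integrable_abs[OF xi_integrable] AE_scaled_max_tendsto_zero[OF p1 T]]
  show "integrable M (\<lambda>\<omega>. (scaled_max T n \<omega>) ^ 1)" for n
    using dominated(1) T by simp
  show "(\<lambda>n. expectation (\<lambda>\<omega>. (scaled_max T n \<omega>) ^ 1)) \<longlonglongrightarrow> 0"
    using dominated(2) T by simp
qed

lemma converges_L2_scaled_srrw:
  assumes p1: "p < 1" and int: "integrable M (\<lambda>\<omega>. (\<xi> 1 \<omega>)\<^sup>2)"
  shows "converges_Lr_in_D 2 M (scaled_srrw \<xi> \<alpha> \<beta>) (\<lambda>_ _. 0)"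
proof (rule converges_Lr_scaled_srrw)
  fix T :: real assume T: "T > 0"
  have lim: "AE \<omega> in M. (\<lambda>n. (scaled_max T n \<omega>)\<^sup>2) \<longlonglongrightarrow> 0"
    using AE_scaled_max_tendsto_zero[OF p1 T]
  proof eventually_elim
    case (elim \<omega>)
    show ?case using tendsto_power[OF elim, of 2] by simp
  qed
  have N: "real (nat \<lfloor>real n * T\<rfloor>) \<le> real n * T" for n using T by simp
  note dominated = expectation_tendsto_zero_if_dominated[where V="\<lambda>n \<omega>. (scaled_max T n \<omega>)\<^sup>2"
      and H="\<lambda>x. x\<^sup>2" and K=T and T=T and N="\<lambda>n. nat \<lfloor>real n * T\<rfloor>",
      OF _ zero_le_power2 scaled_max_power2_le_average N _ _ _ zero_le_power2 int lim]
  show "integrable M (\<lambda>\<omega>. (scaled_max T n \<omega>)\<^sup>2)" for n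
    using T by (intro dominated(1)) auto
  show "(\<lambda>n. expectation (\<lambda>\<omega>. (scaled_max T n \<omega>)\<^sup>2)) \<longlonglongrightarrow> 0"
    using T by (intro dominated(2)) auto
qed

end

theorem theorem2p6:
  fixes M :: "'a measure"
    and p \<gamma> :: real and \<mu> :: "nat \<Rightarrow> real"
    and \<xi> :: "nat \<Rightarrow> 'a \<Rightarrow> real"
    and \<alpha> :: "nat \<Rightarrow> 'a \<Rightarrow> bool"
    and \<beta> :: "nat \<Rightarrow> 'a \<Rightarrow> nat"
  assumes "srrw_rvm M p \<gamma> \<mu> \<xi> \<alpha> \<beta>"
    and "p < 1"
  shows "converges_as_in_D M (scaled_srrw \<xi> \<alpha> \<beta>) (\<lambda>_ _. 0) \<and>
         converges_Lr_in_D 1 M (scaled_srrw \<xi> \<alpha> \<beta>) (\<lambda>_ _. 0) \<and>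
         (integrable M (\<lambda>\<omega>. (\<xi> 1 \<omega>)\<^sup>2) \<longrightarrow>
            converges_Lr_in_D 2 M (scaled_srrw \<xi> \<alpha> \<beta>) (\<lambda>_ _. 0))"
proof -
  interpret srrw_rvm M p \<gamma> \<mu> \<xi> \<alpha> \<beta> by (rule assms(1))
  show ?thesis
    using converges_as_scaled_srrw converges_L1_scaled_srrw converges_L2_scaled_srrw assms(2) by blast
qed

end
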